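(* Let $D\subseteq\mathbb{C}$ be a bounded Jordan domain with at least two boundary curves, let $f:\partial D\to\mathbb{R}$ be piecewise continuous, and let $D_1$ and the operator $F$ on $\mathrm{BHarm}(D_1)$ be as defined in the context. Let $u\in\mathrm{BHarm}(D_1)$ be the fixed point of $F$. Then $u$ extends to a harmonic function on $D$ (still denoted $u$) such that $f(\zeta)=\lim_{z\to\zeta}u(z)$ for all $\zeta\in\partial D$ at which $f$ is continuous.
   Context: Setting. $D\subseteq\mathbb{C}$ is a bounded Jordan domain: a bounded domain whose boundary consists of $n\ge 2$ pairwise disjoint Jordan curves (no smoothness is assumed). $f:\partial D\to\mathbb{R}$ is piecewise continuous (in particular bounded, with finitely many discontinuities). $\mathrm{BHarm}(D_1)$ is the space of bounded (real-valued) harmonic functions on $D_1$ with the sup norm $\|\cdot\|_\infty$. Arcs and maps. $\sigma_1,\dots,\sigma_{n-1},\tau_1,\dots,\tau_{n-1}$ are pairwise disjoint arcs, each having its endpoints on $\partial D$ and otherwise contained in $D$; $\sigma=\bigcup_j\sigma_j$, $\tau=\bigcup_j\tau_j$; and $D_1=D\setminus\sigma$, $D_2=D\setminus\tau$ are simply connected domains. $\mathbb{D}$ is the open unit disk. For $j=1,2$, $\phi_j$ is a continuous map of $\overline{\mathbb{D}}$ onto $\overline{D_j}$ that is conformal on $\mathbb{D}$ (such maps exist; each point of $\overline{D}\setminus\sigma$ has exactly one preimage under $\phi_1$, and each point of $\overline{D}\setminus\tau$ has exactly one preimage under $\phi_2$, so $\phi_1^{-1}$, $\phi_2^{-1}$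 are well defined on these sets). Put $A_j=\phi_j^{-1}[\partial D]$, $B_1=\phi_1^{-1}[\sigma]$, $B_2=\phi_2^{-1}[\tau]$, all subsets of the unit circle. $P(z,\zeta)=\frac{1-|z|^2}{|z-\zeta|^2}$ is the Poisson kernel and $ds_\zeta$ is arc length in $\zeta$. Integrands below may be undefined at the finitely many preimages of endpoints of the arcs, which does not affect the integrals. The function $h$. $H_1(z)=\frac{1}{2\pi}\int_{A_1}P(\phi_1^{-1}(z),\zeta)f(\phi_1(\zeta))\,ds_\zeta$ for $z\in D_1$ (the harmonic function on $D_1$ with boundary values $f$ on $\partial D$ and $0$ on $\sigma\setminus\partial D$); $H_2(z)=\frac{1}{2\pi}\int_{A_2}P(\phi_2^{-1}(z),\zeta)f(\phi_2(\zeta))\,ds_\zeta$ for $z\in D_2$ (the harmonic function on $D_2$ with boundary values $f$ on $\partial D$ and $0$ on $\tau\setminus\partial D$); $H_3(z)=\frac{1}{2\pi}\int_{B_1}P(\phi_1^{-1}(z),\zeta)H_2(\phi_1(\zeta))\,ds_\zeta$ for $z\in D_1$ (the harmonic function on $D_1$ with boundary values $H_2$ on $\sigma$ and $0$ elsewhere); $h=H_1+H_3$ on $D_1$. The kernel $K$. For $\zeta_1\in B_2$ and $z\in D_1$, $K(z,\zeta_1)=\int_{B_1}P(\phi_2^{-1}(\phi_1(\zeta)),\zeta_1)\,P(\phi_1^{-1}(z),\zeta)\,ds_\zeta$, i.e. $K(\cdot,\zeta_1)$ is the harmonic function on $D_1$ with boundary values $2\pi P(\phi_2^{-1}(\zeta),\zeta_1)$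 for $\zeta\in\sigma$ and $0$ for boundary points not in $\sigma$. The operator $F$. For $v\in\mathrm{BHarm}(D_1)$ and $z\in D_1$, $$F(v)(z)=h(z)+\frac{1}{(2\pi)^2}\int_{B_2}K(z,\zeta_1)\,v(\phi_2(\zeta_1))\,ds_{\zeta_1}.$$ $F$ is a contraction of the complete space $\mathrm{BHarm}(D_1)$, so it has exactly one fixed point. *)

theory Defs
  imports "HOL-Complex_Analysis.Complex_Analysis"
begin

section \<open>Bounded harmonic functions\<close>

text \<open>\<open>u\<close> is twice continuously differentiable on the open set \<open>S\<close> with
  \<open>u\<^sub>x\<^sub>x + u\<^sub>y\<^sub>y = 0\<close>.  Here \<open>p, q\<close> are the first order partial derivatives, and
  \<open>p1, p2, q1, q2\<close> are those of \<open>p\<close> and \<open>q\<close>.\<close>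

definition harmonic_on :: "(complex \<Rightarrow> real) \<Rightarrow> complex set \<Rightarrow> bool" where
  "harmonic_on u S \<longleftrightarrow> open S \<and>
     (\<exists>p q p1 p2 q1 q2 :: complex \<Rightarrow> real.
        (\<forall>z\<in>S. (u has_derivative (\<lambda>w. p z * Re w + q z * Im w)) (at z) \<and>
                (p has_derivative (\<lambda>w. p1 z * Re w + p2 z * Im w)) (at z) \<and>
                (q has_derivative (\<lambda>w. q1 z * Re w + q2 z * Im w)) (at z) \<and>
                p1 z + q2 z = 0) \<and>
        continuous_on S p1 \<and> continuous_on S p2 \<and>
        continuous_on S q1 \<and> continuous_on S q2)"

text \<open>Members of \<open>BHarm S\<close> are total functions; only their values on \<open>S\<close> are meaningful.\<close>

definition BHarm :: "complex set \<Rightarrow> (complex \<Rightarrow> real) set" where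
  "BHarm S = {v. harmonic_on v S \<and> bounded (v ` S)}"

section \<open>Jordan domains, boundary data, crosscuts and conformal maps\<close>

definition jordan_curve :: "complex set \<Rightarrow> bool" where
  "jordan_curve C \<longleftrightarrow> (\<exists>\<gamma>. simple_path \<gamma> \<and> pathfinish \<gamma> = pathstart \<gamma> \<and> path_image \<gamma> = C)"

definition bounded_jordan_domain :: "nat \<Rightarrow> complex set \<Rightarrow> bool" where
  "bounded_jordan_domain n D \<longleftrightarrow>
     open D \<and> connected D \<and> D \<noteq> {} \<and> bounded D \<and>
     (\<exists>\<C>. finite \<C> \<and> card \<C> = n \<and> (\<forall>C\<in>\<C>. jordan_curve C) \<and> pairwise disjnt \<C> \<and>
          frontier D = \<Union>\<C>)"

definition piecewise_continuous_on_unit_interval :: "(real \<Rightarrow> real) \<Rightarrow> bool" where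
  "piecewise_continuous_on_unit_interval g \<longleftrightarrow>
     (\<exists>T. finite T \<and> (\<forall>t\<in>{0..1} - T. continuous (at t within {0..1}) g)) \<and>
     (\<forall>t\<in>{0..<1}. \<exists>l. (g \<longlongrightarrow> l) (at_right t)) \<and>
     (\<forall>t\<in>{0<..1}. \<exists>l. (g \<longlongrightarrow> l) (at_left t))"

text \<open>The closed simple paths in the boundary of a Jordan domain are precisely the
  parametrizations of its boundary curves.\<close>

definition piecewise_continuous_on_boundary ::
    "complex set \<Rightarrow> (complex \<Rightarrow> real) \<Rightarrow> bool" where
  "piecewise_continuous_on_boundary D f \<longleftrightarrow>
     (\<forall>\<gamma>. simple_path \<gamma> \<and> pathfinish \<gamma> = pathstart \<gamma> \<and> path_image \<gamma> \<subseteq> frontier D \<longrightarrow>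
          piecewise_continuous_on_unit_interval (f \<circ> \<gamma>))"

definition crosscut :: "complex set \<Rightarrow> (real \<Rightarrow> complex) \<Rightarrow> bool" where
  "crosscut D \<gamma> \<longleftrightarrow> arc \<gamma> \<and> pathstart \<gamma> \<in> frontier D \<and> pathfinish \<gamma> \<in> frontier D \<and>
     path_image \<gamma> - {pathstart \<gamma>, pathfinish \<gamma>} \<subseteq> D"

definition extended_riemann_map :: "(complex \<Rightarrow> complex) \<Rightarrow> complex set \<Rightarrow> bool" where
  "extended_riemann_map \<phi> G \<longleftrightarrow>
     continuous_on (cball 0 1) \<phi> \<and> \<phi> ` cball 0 1 = closure G \<and>
     \<phi> holomorphic_on ball 0 1 \<and> inj_on \<phi> (ball 0 1) \<and> \<phi> ` ball 0 1 = G"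

section \<open>Poisson integrals\<close>

definition poisson_kernel :: "complex \<Rightarrow> complex \<Rightarrow> real" where
  "poisson_kernel z \<zeta> = (1 - (cmod z)\<^sup>2) / (cmod (z - \<zeta>))\<^sup>2"

text \<open>Integration with respect to arc length over the part of \<open>A\<close> in the unit circle.\<close>

definition circle_integral :: "complex set \<Rightarrow> (complex \<Rightarrow> real) \<Rightarrow> real" where
  "circle_integral A g = (LINT t:{t\<in>{0..<2*pi}. cis t \<in> A}|lborel. g (cis t))"

definition disc_preimage :: "(complex \<Rightarrow> complex) \<Rightarrow> complex set \<Rightarrow> complex set" where
  "disc_preimage \<phi> S = {\<zeta> \<in> cball 0 1. \<phi> \<zeta> \<in> S}"

text \<open>An extended Riemann map \<open>\<phi>\<close> of \<open>G\<close> need not be injective on the closed disc, so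
  \<open>disc_inv \<phi> z\<close> is an arbitrary preimage where there are several.  Such points \<open>z\<close> lie on
  the slits removed from \<open>D\<close> to obtain \<open>G\<close>, where it is not used.\<close>

definition disc_inv :: "(complex \<Rightarrow> complex) \<Rightarrow> complex \<Rightarrow> complex" where
  "disc_inv \<phi> = inv_into (cball 0 1) \<phi>"

text \<open>The harmonic function on \<open>\<phi> ` ball 0 1\<close> with boundary values \<open>g\<close> on \<open>S\<close> and \<open>0\<close>
  elsewhere.\<close>

definition poisson_integral ::
    "(complex \<Rightarrow> complex) \<Rightarrow> complex set \<Rightarrow> (complex \<Rightarrow> real) \<Rightarrow> complex \<Rightarrow> real" where
  "poisson_integral \<phi> S g z =
     1 / (2*pi) * circle_integral (disc_preimage \<phi> S)
       (\<lambda>\<zeta>. poisson_kernel (disc_inv \<phi> z) \<zeta> * g (\<phi> \<zeta>))"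

section \<open>The operator\<close>

text \<open>Throughout, \<open>\<sigma>\<close> and \<open>\<tau>\<close> are the unions of the two families of slits, and \<open>\<phi>1\<close>, \<open>\<phi>2\<close>
  are extended Riemann maps of \<open>D - \<sigma>\<close> and \<open>D - \<tau>\<close>.\<close>

definition H1 :: "complex set \<Rightarrow> (complex \<Rightarrow> real) \<Rightarrow> (complex \<Rightarrow> complex) \<Rightarrow> complex \<Rightarrow> real" where
  "H1 D f \<phi>1 = poisson_integral \<phi>1 (frontier D) f"

definition H2 :: "complex set \<Rightarrow> (complex \<Rightarrow> real) \<Rightarrow> (complex \<Rightarrow> complex) \<Rightarrow> complex \<Rightarrow> real" where
  "H2 D f \<phi>2 = poisson_integral \<phi>2 (frontier D) f"

definition H3 ::
    "complex set \<Rightarrow> (complex \<Rightarrow> real) \<Rightarrow> complex set \<Rightarrow>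
     (complex \<Rightarrow> complex) \<Rightarrow> (complex \<Rightarrow> complex) \<Rightarrow> complex \<Rightarrow> real" where
  "H3 D f \<sigma> \<phi>1 \<phi>2 = poisson_integral \<phi>1 \<sigma> (H2 D f \<phi>2)"

definition h_fun ::
    "complex set \<Rightarrow> (complex \<Rightarrow> real) \<Rightarrow> complex set \<Rightarrow>
     (complex \<Rightarrow> complex) \<Rightarrow> (complex \<Rightarrow> complex) \<Rightarrow> complex \<Rightarrow> real" where
  "h_fun D f \<sigma> \<phi>1 \<phi>2 z = H1 D f \<phi>1 z + H3 D f \<sigma> \<phi>1 \<phi>2 z"

definition K_kernel ::
    "complex set \<Rightarrow> (complex \<Rightarrow> complex) \<Rightarrow> (complex \<Rightarrow> complex) \<Rightarrow>
     complex \<Rightarrow> complex \<Rightarrow> real" where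
  "K_kernel \<sigma> \<phi>1 \<phi>2 z \<zeta>1 =
     circle_integral (disc_preimage \<phi>1 \<sigma>)
       (\<lambda>\<zeta>. poisson_kernel (disc_inv \<phi>2 (\<phi>1 \<zeta>)) \<zeta>1 * poisson_kernel (disc_inv \<phi>1 z) \<zeta>)"

definition F_op ::
    "complex set \<Rightarrow> (complex \<Rightarrow> real) \<Rightarrow> complex set \<Rightarrow> complex set \<Rightarrow>
     (complex \<Rightarrow> complex) \<Rightarrow> (complex \<Rightarrow> complex) \<Rightarrow> (complex \<Rightarrow> real) \<Rightarrow> complex \<Rightarrow> real" where
  "F_op D f \<sigma> \<tau> \<phi>1 \<phi>2 v z =
     h_fun D f \<sigma> \<phi>1 \<phi>2 z +
     1 / (2*pi)\<^sup>2 * circle_integral (disc_preimage \<phi>2 \<tau>)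
       (\<lambda>\<zeta>1. K_kernel \<sigma> \<phi>1 \<phi>2 z \<zeta>1 * v (\<phi>2 \<zeta>1))"

end

theory Submission
  imports Defs
begin

text \<open>Let \<open>W\<close> be the Poisson integral on \<open>D - \<tau>\<close> with boundary values \<open>f\<close> on the outer boundary and \<open>u\<close> on the
  slits \<open>\<tau>\<close>.  Interchanging the two integrations in the kernel term of the operator shows that the
  fixed point equation says exactly that \<open>u\<close> is the Poisson integral on \<open>D - \<sigma>\<close> with boundary values
  \<open>f\<close> on the outer boundary and \<open>W\<close> on the slits \<open>\<sigma>\<close> (\<open>fixed_point_representation\<close>).  So \<open>u\<close> and \<open>W\<close>
  are coupled as in the alternating method of Schwarz.

  On \<open>D - (\<sigma> \<union> \<tau>)\<close> the bounded harmonic function \<open>u - W\<close> tends to \<open>0\<close> at all boundary points apart from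
  the discontinuities of \<open>f\<close> and the end points of the slits: on the outer boundary both functions
  tend to \<open>f\<close>; on \<open>\<sigma>\<close> the function \<open>u\<close> has the boundary values \<open>W\<close>, where \<open>W\<close> is continuous; on \<open>\<tau>\<close>
  the roles are exchanged.  Since only finitely many points are exceptional, the maximum principle
  with logarithmic barriers (\<open>harmonic_maximum_principle_except_finite\<close>) gives \<open>u = W\<close> there.  Hence
  \<open>W\<close> continues \<open>u\<close> harmonically across \<open>\<sigma>\<close> (\<open>coupled_solutions_glue\<close>).  At a point of the outer
  boundary that is off \<open>\<sigma>\<close> the limit is read off from \<open>u\<close>; a point of \<open>\<sigma>\<close> is off \<open>\<tau>\<close>, and there it
  is read off from \<open>W\<close>.

  Behind this is one fact on Poisson integrals of bounded Borel data transplanted by a Riemann map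
  that extends continuously to the closed disc: they attain their data wherever the data are
  continuous on the boundary of the image domain (\<open>poisson_integral_tendsto\<close>).  Several points of
  the circle may lie over one boundary point; compactness of the closed disc handles all of them
  at once (\<open>tendsto_pushforward\<close>).\<close>

section \<open>Harmonic functions and the maximum principle\<close>

lemma gradient_unique:
  fixes u :: "complex \<Rightarrow> real"
  assumes "(u has_derivative (\<lambda>w. a * Re w + b * Im w)) (at z)"
  shows "frechet_derivative u (at z) 1 = a" "frechet_derivative u (at z) \<i> = b"
proof -
  have "frechet_derivative u (at z) = (\<lambda>w. a * Re w + b * Im w)"
    using frechet_derivative_at[OF assms] by simp
  then show "frechet_derivative u (at z) 1 = a" "frechet_derivative u (at z) \<i> = b"
    by auto
qed

definition dx :: "(complex \<Rightarrow> real) \<Rightarrow> complex \<Rightarrow> real" where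
  "dx u z = frechet_derivative u (at z) 1"

definition dy :: "(complex \<Rightarrow> real) \<Rightarrow> complex \<Rightarrow> real" where
  "dy u z = frechet_derivative u (at z) \<i>"

text \<open>The existentially quantified partial derivatives in the definition are determined by \<open>u\<close>.
  Naming them makes harmonicity visibly local, so that harmonic functions can be glued.\<close>

lemma harmonic_on_iff:
  "harmonic_on u S \<longleftrightarrow> open S \<and>
     (\<forall>z\<in>S. (u has_derivative (\<lambda>w. dx u z * Re w + dy u z * Im w)) (at z) \<and>
        (dx u has_derivative (\<lambda>w. dx (dx u) z * Re w + dy (dx u) z * Im w)) (at z) \<and>
        (dy u has_derivative (\<lambda>w. dx (dy u) z * Re w + dy (dy u) z * Im w)) (at z) \<and>
        dx (dx u) z + dy (dy u) z = 0) \<and>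
     continuous_on S (dx (dx u)) \<and> continuous_on S (dy (dx u)) \<and>
     continuous_on S (dx (dy u)) \<and> continuous_on S (dy (dy u))" (is "?L \<longleftrightarrow> ?R")
proof
  assume ?R
  then show ?L unfolding harmonic_on_def by blast
next
  assume ?L
  then obtain p q p1 p2 q1 q2 where S: "open S"
    and d: "\<And>z. z \<in> S \<Longrightarrow> (u has_derivative (\<lambda>w. p z * Re w + q z * Im w)) (at z)"
    and dp: "\<And>z. z \<in> S \<Longrightarrow> (p has_derivative (\<lambda>w. p1 z * Re w + p2 z * Im w)) (at z)"
    and dq: "\<And>z. z \<in> S \<Longrightarrow> (q has_derivative (\<lambda>w. q1 z * Re w + q2 z * Im w)) (at z)"
    and lap: "\<And>z. z \<in> S \<Longrightarrow> p1 z + q2 z = 0"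
    and cont: "continuous_on S p1" "continuous_on S p2" "continuous_on S q1" "continuous_on S q2"
    unfolding harmonic_on_def by blast
  have p: "dx u z = p z" "dy u z = q z" if "z \<in> S" for z
    using gradient_unique[OF d[OF that]] by (simp_all add: dx_def dy_def)
  have dp': "(dx u has_derivative (\<lambda>w. p1 z * Re w + p2 z * Im w)) (at z)" if "z \<in> S" for z
    by (rule has_derivative_transform_within_open[OF dp[OF that] S that]) (simp add: p)
  have dq': "(dy u has_derivative (\<lambda>w. q1 z * Re w + q2 z * Im w)) (at z)" if "z \<in> S" for z
    by (rule has_derivative_transform_within_open[OF dq[OF that] S that]) (simp add: p)
  have pp: "dx (dx u) z = p1 z" "dy (dx u) z = p2 z" "dx (dy u) z = q1 z" "dy (dy u) z = q2 z"
    if "z \<in> S" for z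
    using gradient_unique[OF dp'[OF that]] gradient_unique[OF dq'[OF that]]
    by (simp_all add: dx_def dy_def)
  have "continuous_on S (dx (dx u))" "continuous_on S (dy (dx u))"
     "continuous_on S (dx (dy u))" "continuous_on S (dy (dy u))"
    using cont by (simp_all add: pp cong: continuous_on_cong)
  then show ?R
    using S d dp' dq' lap by (simp add: p pp)
qed

lemma harmonic_onI:
  assumes "open S"
    and "\<And>z. z \<in> S \<Longrightarrow> (u has_derivative (\<lambda>w. p z * Re w + q z * Im w)) (at z)"
    and "\<And>z. z \<in> S \<Longrightarrow> (p has_derivative (\<lambda>w. p1 z * Re w + p2 z * Im w)) (at z)"
    and "\<And>z. z \<in> S \<Longrightarrow> (q has_derivative (\<lambda>w. q1 z * Re w + q2 z * Im w)) (at z)"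
    and "\<And>z. z \<in> S \<Longrightarrow> p1 z + q2 z = 0"
    and "continuous_on S p1" "continuous_on S p2" "continuous_on S q1" "continuous_on S q2"
  shows "harmonic_on u S"
  using assms unfolding harmonic_on_def by blast

lemma harmonic_onD:
  assumes "harmonic_on u S"
  shows "open S"
    and "\<And>z. z \<in> S \<Longrightarrow> (u has_derivative (\<lambda>w. dx u z * Re w + dy u z * Im w)) (at z)"
    and "\<And>z. z \<in> S \<Longrightarrow> (dx u has_derivative (\<lambda>w. dx (dx u) z * Re w + dy (dx u) z * Im w)) (at z)"
    and "\<And>z. z \<in> S \<Longrightarrow> (dy u has_derivative (\<lambda>w. dx (dy u) z * Re w + dy (dy u) z * Im w)) (at z)"
    and "\<And>z. z \<in> S \<Longrightarrow> dx (dx u) z + dy (dy u) z = 0"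
    and "continuous_on S (dx (dx u))" "continuous_on S (dy (dx u))"
    and "continuous_on S (dx (dy u))" "continuous_on S (dy (dy u))"
  using assms unfolding harmonic_on_iff by simp_all

lemma harmonic_on_Un:
  assumes "harmonic_on u A" "harmonic_on u B"
  shows "harmonic_on u (A \<union> B)"
  using assms by (auto simp: harmonic_on_iff intro: continuous_on_open_Un)

lemma harmonic_on_subset:
  assumes "harmonic_on u S" "open T" "T \<subseteq> S"
  shows "harmonic_on u T"
  using assms unfolding harmonic_on_iff by (auto intro: continuous_on_subset)

lemma harmonic_on_cong:
  assumes "harmonic_on u S" and eq: "\<And>z. z \<in> S \<Longrightarrow> v z = u z"
  shows "harmonic_on v S"
proof -
  note u = harmonic_onD[OF assms(1)]
  have "(v has_derivative (\<lambda>w. dx u z * Re w + dy u z * Im w)) (at z)" if "z \<in> S" for z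
    by (rule has_derivative_transform_within_open[OF u(2)[OF that] u(1) that]) (simp add: eq)
  then show ?thesis by (rule harmonic_onI[OF u(1) _ u(3-)])
qed

lemma harmonic_on_imp_open: "harmonic_on u S \<Longrightarrow> open S"
  by (simp add: harmonic_on_def)

lemma harmonic_on_imp_continuous_on:
  assumes "harmonic_on u S" shows "continuous_on S u"
  using assms unfolding harmonic_on_iff
  by (meson continuous_at_imp_continuous_on has_derivative_continuous)

lemma harmonic_on_add:
  assumes "harmonic_on u S" "harmonic_on v S"
  shows "harmonic_on (\<lambda>z. u z + v z) S"
proof -
  note u = harmonic_onD[OF assms(1)] and v = harmonic_onD[OF assms(2)]
  show ?thesis
  proof (rule harmonic_onI)
    fix z assume z: "z \<in> S"
    show "((\<lambda>z. u z + v z) has_derivative (\<lambda>w. (dx u z + dx v z) * Re w + (dy u z + dy v z) * Im w)) (at z)"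
      by (rule has_derivative_eq_rhs[OF has_derivative_add[OF u(2) v(2)]])
        (use z in \<open>auto simp: algebra_simps\<close>)
    show "((\<lambda>z. dx u z + dx v z) has_derivative
        (\<lambda>w. (dx (dx u) z + dx (dx v) z) * Re w + (dy (dx u) z + dy (dx v) z) * Im w)) (at z)"
      by (rule has_derivative_eq_rhs[OF has_derivative_add[OF u(3) v(3)]])
        (use z in \<open>auto simp: algebra_simps\<close>)
    show "((\<lambda>z. dy u z + dy v z) has_derivative
        (\<lambda>w. (dx (dy u) z + dx (dy v) z) * Re w + (dy (dy u) z + dy (dy v) z) * Im w)) (at z)"
      by (rule has_derivative_eq_rhs[OF has_derivative_add[OF u(4) v(4)]])
        (use z in \<open>auto simp: algebra_simps\<close>)
    show "(dx (dx u) z + dx (dx v) z) + (dy (dy u) z + dy (dy v) z) = 0"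
      using u(5)[OF z] v(5)[OF z] by simp
  qed (intro u continuous_on_add v)+
qed

lemma harmonic_on_cmult:
  assumes "harmonic_on u S"
  shows "harmonic_on (\<lambda>z. c * u z) S"
proof -
  note u = harmonic_onD[OF assms(1)]
  show ?thesis
  proof (rule harmonic_onI)
    fix z assume z: "z \<in> S"
    show "((\<lambda>z. c * u z) has_derivative (\<lambda>w. (c * dx u z) * Re w + (c * dy u z) * Im w)) (at z)"
      by (rule has_derivative_eq_rhs[OF has_derivative_mult_right[OF u(2)]])
        (use z in \<open>auto simp: algebra_simps\<close>)
    show "((\<lambda>z. c * dx u z) has_derivative
        (\<lambda>w. (c * dx (dx u) z) * Re w + (c * dy (dx u) z) * Im w)) (at z)"
      by (rule has_derivative_eq_rhs[OF has_derivative_mult_right[OF u(3)]])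
        (use z in \<open>auto simp: algebra_simps\<close>)
    show "((\<lambda>z. c * dy u z) has_derivative
        (\<lambda>w. (c * dx (dy u) z) * Re w + (c * dy (dy u) z) * Im w)) (at z)"
      by (rule has_derivative_eq_rhs[OF has_derivative_mult_right[OF u(4)]])
        (use z in \<open>auto simp: algebra_simps\<close>)
    show "c * dx (dx u) z + c * dy (dy u) z = 0"
      using u(5)[OF z] by (simp flip: distrib_left)
  qed (intro u continuous_on_mult_left)+
qed

lemma harmonic_on_diff:
  assumes "harmonic_on u S" "harmonic_on v S"
  shows "harmonic_on (\<lambda>z. u z - v z) S"
  using harmonic_on_add[OF assms(1) harmonic_on_cmult[OF assms(2), of "-1"]] by simp

lemma harmonic_on_const: "open S \<Longrightarrow> harmonic_on (\<lambda>_. c) S"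
  by (rule harmonic_onI[where p = "\<lambda>_. 0" and q = "\<lambda>_. 0" and ?p1.0 = "\<lambda>_. 0"
        and ?p2.0 = "\<lambda>_. 0" and ?q1.0 = "\<lambda>_. 0" and ?q2.0 = "\<lambda>_. 0"]) auto

lemma harmonic_on_sum:
  assumes "open S" and "\<And>i. i \<in> I \<Longrightarrow> harmonic_on (u i) S"
  shows "harmonic_on (\<lambda>z. \<Sum>i\<in>I. u i z) S"
  using assms(2)
proof (induction I rule: infinite_finite_induct)
  case (insert i I)
  have "harmonic_on (\<lambda>z. u i z + (\<Sum>i\<in>I. u i z)) S"
    by (intro harmonic_on_add insert) (auto intro: insert)
  then show ?case using insert by simp
qed (auto simp: harmonic_on_const[OF assms(1)])

lemma harmonic_on_Re_holomorphic:
  assumes "F holomorphic_on S" "open S"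
  shows "harmonic_on (\<lambda>z. Re (F z)) S"
proof -
  have F: "(F has_derivative (\<lambda>w. deriv F z * w)) (at z)" if "z \<in> S" for z
    using holomorphic_derivI[OF assms that] unfolding has_field_derivative_def by simp
  have F': "deriv F holomorphic_on S" by (rule holomorphic_deriv[OF assms])
  have F1: "(deriv F has_derivative (\<lambda>w. deriv (deriv F) z * w)) (at z)" if "z \<in> S" for z
    using holomorphic_derivI[OF F' assms(2) that] unfolding has_field_derivative_def by simp
  have F'': "continuous_on S (deriv (deriv F))"
    by (rule holomorphic_on_imp_continuous_on[OF holomorphic_deriv[OF F' assms(2)]])
  show ?thesis
    apply (rule harmonic_onI[where p = "\<lambda>z. Re (deriv F z)" and q = "\<lambda>z. - Im (deriv F z)" and
          ?p1.0 = "\<lambda>z. Re (deriv (deriv F) z)" and ?p2.0 = "\<lambda>z. - Im (deriv (deriv F) z)" and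
          ?q1.0 = "\<lambda>z. - Im (deriv (deriv F) z)" and ?q2.0 = "\<lambda>z. - Re (deriv (deriv F) z)"])
    subgoal by fact
    subgoal for z by (rule has_derivative_eq_rhs[OF has_derivative_Re[OF F]]) auto
    subgoal for z by (rule has_derivative_eq_rhs[OF has_derivative_Re[OF F1]]) auto
    subgoal for z
      by (rule has_derivative_eq_rhs[OF has_derivative_minus[OF has_derivative_Im[OF F1]]]) 
        (auto simp: algebra_simps)
    by (auto intro!: continuous_intros F'')
qed

text \<open>A single branch of the logarithm does not cover the punctured plane, but the branches
  cut along two opposite rays do, and both have the real part \<open>ln \<bar>z - e\<bar>\<close>.\<close>

lemma harmonic_on_ln_cmod: "harmonic_on (\<lambda>z. ln (cmod (z - e))) (- {e})"
proof -
  define A where "A = {z. z - e \<notin> \<real>\<^sub>\<le>\<^sub>0}"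
  define B where "B = {z. e - z \<notin> \<real>\<^sub>\<le>\<^sub>0}"
  have "A = (\<lambda>z. z - e) -` (- \<real>\<^sub>\<le>\<^sub>0)" "B = (\<lambda>z. e - z) -` (- \<real>\<^sub>\<le>\<^sub>0)"
    by (auto simp: A_def B_def)
  then have op: "open A" "open B"
    by (auto intro!: open_vimage continuous_intros)
  have ln_diff: "Re (Ln w) = ln (cmod w)" if "w \<notin> \<real>\<^sub>\<le>\<^sub>0" for w
    using that by (cases "w = 0") auto
  have "(\<lambda>z. Ln (z - e)) holomorphic_on A"
    by (intro holomorphic_intros) (auto simp: A_def)
  then have "harmonic_on (\<lambda>z. ln (cmod (z - e))) A"
    by (rule harmonic_on_cong[OF harmonic_on_Re_holomorphic[OF _ op(1)]])
      (simp add: A_def ln_diff)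
  moreover have "(\<lambda>z. Ln (e - z)) holomorphic_on B"
    by (intro holomorphic_intros) (auto simp: B_def)
  then have "harmonic_on (\<lambda>z. ln (cmod (z - e))) B"
    by (rule harmonic_on_cong[OF harmonic_on_Re_holomorphic[OF _ op(2)]])
      (simp add: B_def ln_diff norm_minus_commute)
  ultimately have "harmonic_on (\<lambda>z. ln (cmod (z - e))) (A \<union> B)"
    by (rule harmonic_on_Un)
  moreover have "z \<in> A \<union> B \<longleftrightarrow> z \<in> - {e}" for z
    unfolding A_def B_def Un_iff mem_Collect_eq complex_nonpos_Reals_iff Compl_iff singleton_iff
      complex_eq_iff minus_complex.simps by linarith
  then have "A \<union> B = - {e}" by blast
  ultimately show ?thesis by simp
qed

lemma no_local_max_of_pos_second_derivative:
  fixes g g' :: "real \<Rightarrow> real"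
  assumes "0 < r"
    and g: "\<And>x. \<bar>x\<bar> < r \<Longrightarrow> (g has_real_derivative g' x) (at x)"
    and g': "(g' has_real_derivative l) (at 0)" and "l > 0"
    and max: "\<And>x. \<bar>x\<bar> < r \<Longrightarrow> g x \<le> g 0"
  shows False
proof -
  have "g' 0 = 0"
    by (rule DERIV_local_max[OF g \<open>0 < r\<close>]) (use max \<open>0 < r\<close> in auto)
  with DERIV_pos_inc_right[OF g' \<open>l > 0\<close>] obtain d where d: "d > 0"
    "\<And>x. 0 < x \<Longrightarrow> x < d \<Longrightarrow> 0 < g' x" by auto
  define x where "x = min d r / 2"
  have x: "0 < x" "x < d" "x < r" using d(1) \<open>0 < r\<close> by (auto simp: x_def)
  have "g 0 < g x"
  proof (rule DERIV_pos_imp_increasing_open[OF x(1)])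
    show "\<exists>y'. (g has_real_derivative y') (at y) \<and> 0 < y'" if "0 < y" "y < x" for y
      using g[of y] d(2)[of y] that x by auto
    show "continuous_on {0..x} g"
      by (rule continuous_at_imp_continuous_on) (use g x in \<open>force intro: DERIV_isCont\<close>)
  qed
  with max[of x] x show False by simp
qed

lemma eventually_at_within_mono:
  assumes "eventually P (at q within S)" "\<And>z. z \<in> S \<Longrightarrow> P z \<Longrightarrow> Q z"
  shows "eventually Q (at q within S)"
  using assms by (auto simp: eventually_at_filter elim: eventually_mono)

lemma has_real_derivative_along_line:
  fixes u :: "complex \<Rightarrow> real"
  assumes "(u has_derivative (\<lambda>w. a * Re w + b * Im w)) (at (z + of_real x * d))"
  shows "((\<lambda>x. u (z + of_real x * d)) has_real_derivative a * Re d + b * Im d) (at x)"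
proof -
  have "((\<lambda>x. z + of_real x * d) has_derivative (\<lambda>y. of_real y * d)) (at x)"
    by (auto intro!: derivative_eq_intros)
  from has_derivative_compose[OF this assms] show ?thesis
    unfolding has_field_derivative_def
    by (rule has_derivative_eq_rhs) (auto simp: fun_eq_iff algebra_simps)
qed

text \<open>Adding \<open>\<delta> |z|\<^sup>2\<close> makes the Laplacian positive, so at every point one of the
  pure second partial derivatives is positive, which excludes interior maxima.\<close>

lemma harmonic_plus_square_no_max:
  assumes "harmonic_on u S" "z \<in> S" "\<delta> > 0"
  shows "\<exists>w\<in>S. u w + \<delta> * (cmod w)\<^sup>2 > u z + \<delta> * (cmod z)\<^sup>2"
proof (rule ccontr)
  assume "\<not> ?thesis"
  then have max: "\<And>w. w \<in> S \<Longrightarrow> u w + \<delta> * (cmod w)\<^sup>2 \<le> u z + \<delta> * (cmod z)\<^sup>2"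
    by (meson not_le)
  note u = harmonic_onD[OF assms(1)]
  obtain r where r: "r > 0" "ball z r \<subseteq> S" using u(1) assms(2) openE by blast
  have dir: False
    if d: "cmod d = 1"
      and k: "((\<lambda>x. dx u (z + of_real x * d) * Re d + dy u (z + of_real x * d) * Im d)
                has_real_derivative l) (at 0)" "l + 2 * \<delta> > 0" for d l
  proof (rule no_local_max_of_pos_second_derivative[OF r(1)])
    have S: "z + of_real x * d \<in> S" if "\<bar>x\<bar> < r" for x
      using r(2) that d by (auto simp: dist_norm norm_mult)
    have d2: "(Re d)\<^sup>2 + (Im d)\<^sup>2 = 1"
      using d by (simp flip: cmod_power2)
    have norm: "(cmod (z + of_real x * d))\<^sup>2 = (cmod z)\<^sup>2 + 2 * x * (z \<bullet> d) + x\<^sup>2" for x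
    proof -
      have "(cmod (z + of_real x * d))\<^sup>2
          = (cmod z)\<^sup>2 + 2 * x * (z \<bullet> d) + x\<^sup>2 * ((Re d)\<^sup>2 + (Im d)\<^sup>2)"
        unfolding cmod_power2 by (simp add: inner_complex_def power2_eq_square algebra_simps)
      then show ?thesis by (simp add: d2)
    qed
    show "((\<lambda>x. u (z + of_real x * d) + \<delta> * (cmod (z + of_real x * d))\<^sup>2) has_real_derivative
          (dx u (z + of_real x * d) * Re d + dy u (z + of_real x * d) * Im d) + \<delta> * (2 * (z \<bullet> d) + 2 * x))
          (at x)"
      if "\<bar>x\<bar> < r" for x
      unfolding norm
      by (rule DERIV_add[OF has_real_derivative_along_line[OF u(2)[OF S[OF that]]]])
        (auto intro!: derivative_eq_intros)
    show "((\<lambda>x. (dx u (z + of_real x * d) * Re d + dy u (z + of_real x * d) * Im d) 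
            + \<delta> * (2 * (z \<bullet> d) + 2 * x)) has_real_derivative l + \<delta> * 2) (at 0)"
      by (rule DERIV_add[OF k(1)]) (auto intro!: derivative_eq_intros)
  next
    fix x :: real assume "\<bar>x\<bar> < r"
    then have "z + of_real x * d \<in> S" using r(2) d by (auto simp: dist_norm norm_mult)
    then show "u (z + of_real x * d) + \<delta> * (cmod (z + of_real x * d))\<^sup>2
      \<le> u (z + of_real 0 * d) + \<delta> * (cmod (z + of_real 0 * d))\<^sup>2"
      using max by simp
  qed (use k(2) in auto)
  consider "dx (dx u) z + 2 * \<delta> > 0" | "dy (dy u) z + 2 * \<delta> > 0"
    using u(5)[OF assms(2)] assms(3) by linarith
  then show False
  proof cases
    case 1
    have "((\<lambda>x. dx u (z + of_real x * 1)) has_real_derivative dx (dx u) z * Re 1 + dy (dx u) z * Im 1) (at 0)"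
      by (rule has_real_derivative_along_line) (use u(3) assms(2) in auto)
    with 1 show False using dir[of 1 "dx (dx u) z"] by simp
  next
    case 2
    have "((\<lambda>x. dy u (z + of_real x * \<i>)) has_real_derivative dx (dy u) z * Re \<i> + dy (dy u) z * Im \<i>) (at 0)"
      by (rule has_real_derivative_along_line) (use u(4) assms(2) in auto)
    with 2 show False using dir[of \<i> "dy (dy u) z"] by simp
  qed
qed

text \<open>At the points of \<open>E\<close> nothing but the upper bound \<open>M\<close> is known.  The sum of \<open>ln (2R / |z - e|)\<close> over these points \<open>e\<close> is a positive harmonic barrier
  which tends to \<open>\<infinity>\<close> at every exceptional point; subtracting a small multiple of it makes the
  exceptional points harmless, and this multiple can be chosen after the point at which the
  inequality is to be proved.\<close>

theorem harmonic_maximum_principle_except_finite: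
  assumes harm: "harmonic_on v S" and "bounded S" "finite E"
    and bdd: "\<And>z. z \<in> S \<Longrightarrow> v z \<le> M"
    and bdry: "\<And>q. q \<in> frontier S \<Longrightarrow> q \<notin> E \<Longrightarrow> (v \<longlongrightarrow> 0) (at q within S)"
    and "z0 \<in> S"
  shows "v z0 \<le> 0"
proof (rule ccontr)
  assume "\<not> v z0 \<le> 0"
  then have pos: "v z0 > 0" by simp
  have S: "open S" using harm by (rule harmonic_on_imp_open)
  \<comment> \<open>The barrier must be finite on \<open>S\<close>, so only exceptional points outside of \<open>S\<close> get a pole.\<close>
  define E' where "E' = E - S"
  have E': "finite E'" using \<open>finite E\<close> by (simp add: E'_def)
  have "bounded (S \<union> E')" using \<open>bounded S\<close> E' by (simp add: finite_imp_bounded)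
  then obtain R where R: "R > 0" "\<And>z. z \<in> S \<union> E' \<Longrightarrow> cmod z < R"
    by (meson bounded_pos_less)
  define b where "b z = (\<Sum>e\<in>E'. ln (2 * R) - ln (cmod (z - e)))" for z
  have b_term: "ln (2 * R) - ln (cmod (z - e)) \<ge> 0" if "z \<in> S" "e \<in> E'" for z e
  proof -
    have "cmod (z - e) < 2 * R" using R(2)[of z] R(2)[of e] that norm_triangle_ineq4[of z e] by auto
    moreover have "cmod (z - e) > 0" using that by (auto simp: E'_def)
    ultimately have "ln (cmod (z - e)) \<le> ln (2 * R)" by (intro ln_mono) auto
    then show ?thesis by simp
  qed
  have b_nonneg: "b z \<ge> 0" if "z \<in> S" for z
    unfolding b_def by (rule sum_nonneg) (use b_term that in auto)
  have b_harm: "harmonic_on b S"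
    unfolding b_def
    by (intro harmonic_on_sum S harmonic_on_diff harmonic_on_const
        harmonic_on_subset[OF harmonic_on_ln_cmod]) (auto simp: E'_def)
  have b_lim: "filterlim b at_top (at e within S)" if e: "e \<in> E'" for e
  proof -
    have "((\<lambda>z. cmod (z - e)) \<longlongrightarrow> 0) (at e within S)"
      by (auto intro!: tendsto_eq_intros)
    moreover have "eventually (\<lambda>z. 0 < cmod (z - e)) (at e within S)"
      by (auto simp: eventually_at_filter)
    ultimately have "filterlim (\<lambda>z. cmod (z - e)) (at_right 0) (at e within S)"
      by (auto simp: filterlim_at elim: eventually_mono)
    then have "filterlim (\<lambda>z. ln (cmod (z - e))) at_bot (at e within S)"
      by (rule filterlim_compose[OF ln_at_0])
    then have lim: "filterlim (\<lambda>z. ln (2 * R) + - ln (cmod (z - e))) at_top (at e within S)"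
      by (intro filterlim_tendsto_add_at_top[OF tendsto_const]) (simp add: filterlim_uminus_at_bot)
    have "eventually (\<lambda>z. ln (2 * R) + - ln (cmod (z - e)) \<le> b z) (at e within S)"
    proof (rule eventually_at_topological[THEN iffD2], intro exI[of _ UNIV] conjI ballI impI)
      fix z assume "z \<in> S"
      then show "ln (2 * R) + - ln (cmod (z - e)) \<le> b z"
        using member_le_sum[OF e, of "\<lambda>e. ln (2 * R) - ln (cmod (z - e))"] b_term E'
        by (auto simp: b_def)
    qed auto
    with lim show ?thesis by (rule filterlim_at_top_mono)
  qed
  \<comment> \<open>Half of the value at \<open>z0\<close> survives the barrier, and \<open>\<delta> |z|\<^sup>2\<close> stays below that half.\<close>
  define \<epsilon> where "\<epsilon> = v z0 / (2 * (b z0 + 1))"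
  have \<epsilon>: "\<epsilon> > 0" "\<epsilon> * b z0 \<le> v z0 / 2"
    using pos b_nonneg[OF \<open>z0 \<in> S\<close>] by (auto simp: \<epsilon>_def field_simps)
  define \<delta> where "\<delta> = v z0 / (4 * R\<^sup>2)"
  have \<delta>: "\<delta> > 0" using pos R(1) by (simp add: \<delta>_def)
  have \<delta>R: "\<delta> * (cmod z)\<^sup>2 \<le> v z0 / 4" if "z \<in> S" for z
  proof -
    have "(cmod z)\<^sup>2 \<le> R\<^sup>2" using R(2)[of z] that by (simp add: power_mono)
    then have "\<delta> * (cmod z)\<^sup>2 \<le> \<delta> * R\<^sup>2" using \<delta> by simp
    also have "\<dots> = v z0 / 4" using R(1) by (simp add: \<delta>_def)
    finally show ?thesis .
  qed
  define w where "w z = (v z - \<epsilon> * b z) + \<delta> * (cmod z)\<^sup>2" for z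
  have w_harm: "harmonic_on (\<lambda>z. v z - \<epsilon> * b z) S"
    by (intro harmonic_on_diff harmonic_on_cmult harm b_harm)
  have w_cont: "continuous_on S w"
    unfolding w_def by (intro continuous_intros harmonic_on_imp_continuous_on[OF w_harm])
  have w0: "w z0 \<ge> v z0 / 2"
    using \<epsilon>(2) \<delta> by (simp add: w_def add_increasing2)
  define K where "K = {z\<in>S. w z \<ge> w z0}"
  have small: "eventually (\<lambda>z. w z < w z0) (at q within S)" if q: "q \<in> frontier S" for q
  proof (cases "q \<in> E")
    case False
    have "eventually (\<lambda>z. v z < v z0 / 4) (at q within S)"
      using bdry[OF q False] pos by (intro order_tendstoD) auto
    then show ?thesis
    proof (rule eventually_at_within_mono)
      fix z assume "z \<in> S" "v z < v z0 / 4"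
      then show "w z < w z0"
        using w0 \<delta>R[of z] b_nonneg[of z] \<epsilon>(1) mult_nonneg_nonneg[of \<epsilon> "b z"]
        unfolding w_def by linarith
    qed
  next
    case True
    then have "q \<in> E'" using q S by (auto simp: E'_def frontier_def interior_open)
    then have "eventually (\<lambda>z. b z > (M + v z0) / \<epsilon>) (at q within S)"
      using b_lim by (simp add: filterlim_at_top_dense)
    then show ?thesis
    proof (rule eventually_at_within_mono)
      fix z assume z: "z \<in> S" "b z > (M + v z0) / \<epsilon>"
      then have "\<epsilon> * b z > M + v z0" using \<epsilon>(1) by (simp add: field_simps)
      then show "w z < w z0"
        using w0 \<delta>R[of z] bdd[of z] pos z(1) unfolding w_def by linarith
    qed
  qed
  \<comment> \<open>Near the boundary \<open>w\<close> stays below \<open>w z0\<close>, so \<open>w\<close> has an interior maximum on \<open>S\<close>.\<close>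
  have "closed K"
    unfolding closed_limpt
  proof (intro allI impI)
    fix q assume q: "q islimpt K"
    then have "q \<in> closure S" 
      by (auto simp: closure_def K_def intro: islimpt_subset)
    show "q \<in> K"
    proof (cases "q \<in> S")
      case True
      have "isCont w q" using w_cont S True by (simp add: continuous_on_eq_continuous_at)
      then have "(w \<longlongrightarrow> w q) (at q within K)"
        using isCont_def tendsto_within_subset by blast
      moreover have "eventually (\<lambda>z. w z \<ge> w z0) (at q within K)"
        by (auto simp: eventually_at_filter K_def)
      ultimately have "w q \<ge> w z0"
        using q by (intro tendsto_lowerbound) (auto simp: trivial_limit_within)
      then show ?thesis using True by (simp add: K_def)
    next
      case False
      then have "q \<in> frontier S"
        using \<open>q \<in> closure S\<close> S by (simp add: frontier_def interior_open)
      from small[OF this] have "eventually (\<lambda>z. w z < w z0) (at q within K)"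
        by (rule filter_leD[OF at_le, rotated]) (auto simp: K_def)
      moreover have "eventually (\<lambda>z. w z \<ge> w z0) (at q within K)"
        by (auto simp: eventually_at_filter K_def)
      ultimately have "eventually (\<lambda>_. False) (at q within K)"
        by eventually_elim simp
      then show ?thesis using q by (simp add: trivial_limit_within eventually_False)
    qed
  qed
  moreover have "bounded K" using \<open>bounded S\<close> by (rule bounded_subset) (auto simp: K_def)
  ultimately have "compact K" by (simp add: compact_eq_bounded_closed)
  moreover have "z0 \<in> K" using \<open>z0 \<in> S\<close> by (simp add: K_def)
  ultimately obtain z1 where z1: "z1 \<in> K" "\<And>z. z \<in> K \<Longrightarrow> w z \<le> w z1"
    using continuous_attains_sup[of K w] continuous_on_subset[OF w_cont, of K]
    by (auto simp: K_def)
  have "z1 \<in> S" using z1(1) by (simp add: K_def)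
  then obtain z where "z \<in> S" "w z > w z1"
    using harmonic_plus_square_no_max[OF w_harm _ \<delta>, of z1] by (auto simp: w_def)
  moreover from this z1 have "z \<in> K" by (simp add: K_def)
  ultimately show False using z1(2)[of z] by simp
qed

section \<open>Poisson integrals on the unit disc\<close>

definition angle_measure :: "real measure" where
  "angle_measure = restrict_space lborel {0..<2*pi}"

lemma finite_measure_angle: "finite_measure angle_measure"
  by (rule finite_measureI)
    (simp add: angle_measure_def emeasure_restrict_space space_restrict_space)

lemma measure_angle [simp]: "measure angle_measure (space angle_measure) = 2 * pi"
  unfolding angle_measure_def by (simp add: measure_restrict_space space_restrict_space)

lemma measurable_angle: "g \<in> measurable borel N \<Longrightarrow> g \<in> measurable angle_measure N"
  unfolding angle_measure_def by (simp add: measurable_restrict_space1)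

lemma integral_angle:
  fixes g :: "real \<Rightarrow> 'a :: {banach, second_countable_topology}"
  shows "integral\<^sup>L angle_measure g = (\<integral>t. indicator {0..<2*pi} t *\<^sub>R g t \<partial>lborel)"
  unfolding angle_measure_def by (rule integral_restrict_space) simp

lemma borel_measurable_cis [measurable]: "cis \<in> borel_measurable borel"
  by (intro borel_measurable_continuous_onI) (auto intro!: continuous_intros)

lemma integrable_angle_bounded:
  fixes g :: "real \<Rightarrow> 'a :: {banach, second_countable_topology}"
  assumes "g \<in> borel_measurable borel" "\<And>t. norm (g t) \<le> B"
  shows "integrable angle_measure g"
  by (rule finite_measure.integrable_const_bound[OF finite_measure_angle, where B = B])
    (use assms in \<open>auto intro: measurable_angle\<close>)

lemma poisson_kernel_measurable [measurable (raw)]: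
  assumes [measurable]: "a \<in> borel_measurable M" "b \<in> borel_measurable M"
  shows "(\<lambda>x. poisson_kernel (a x) (b x)) \<in> borel_measurable M"
  unfolding poisson_kernel_def by measurable

lemma poisson_kernel_nonneg: "cmod w \<le> 1 \<Longrightarrow> poisson_kernel w \<zeta> \<ge> 0"
  by (simp add: poisson_kernel_def power_le_one)

lemma poisson_kernel_eq_0: "cmod w = 1 \<Longrightarrow> poisson_kernel w \<zeta> = 0"
  by (simp add: poisson_kernel_def)

lemma poisson_kernel_le:
  assumes "cmod w \<le> 1" "d > 0" "cmod (w - \<zeta>) \<ge> d"
  shows "poisson_kernel w \<zeta> \<le> (1 - (cmod w)\<^sup>2) / d\<^sup>2"
proof -
  have "0 < cmod (w - \<zeta>)" using assms by linarith
  then show ?thesis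
    unfolding poisson_kernel_def
    by (intro divide_left_mono power_mono mult_pos_pos zero_less_power)
      (use assms in \<open>auto simp: power_le_one\<close>)
qed

lemma poisson_kernel_bound:
  assumes "cmod w \<le> 1"
  obtains B where "B \<ge> 0" "\<And>\<zeta>. cmod \<zeta> = 1 \<Longrightarrow> \<bar>poisson_kernel w \<zeta>\<bar> \<le> B"
proof (cases "cmod w = 1")
  case True
  then show ?thesis using that[of 0] by (simp add: poisson_kernel_eq_0)
next
  case False
  with assms have w: "cmod w < 1" by simp
  show ?thesis
  proof (rule that)
    show "0 \<le> (1 - (cmod w)\<^sup>2) / (1 - cmod w)\<^sup>2" using w by (simp add: power_le_one)
    fix \<zeta> :: complex assume "cmod \<zeta> = 1"
    then have "1 - cmod w \<le> cmod (w - \<zeta>)" by (metis norm_minus_commute norm_triangle_ineq2)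
    then show "\<bar>poisson_kernel w \<zeta>\<bar> \<le> (1 - (cmod w)\<^sup>2) / (1 - cmod w)\<^sup>2"
      using poisson_kernel_le[of w "1 - cmod w" \<zeta>] poisson_kernel_nonneg[of w \<zeta>] w by simp
  qed
qed

lemma poisson_kernel_eq_Re:
  assumes "cmod w < 1"
  shows "poisson_kernel w (cis t) = Re (2 / (1 - w * cis (- t)) - 1)"
proof -
  define \<zeta> where "\<zeta> = cis t"
  have \<zeta>: "cmod \<zeta> = 1" "\<zeta> \<noteq> 0" by (auto simp: \<zeta>_def)
  have ne: "\<zeta> - w \<noteq> 0" using assms \<zeta> by auto
  have "1 - w * cis (- t) = (\<zeta> - w) / \<zeta>"
    using \<zeta> by (simp add: \<zeta>_def left_diff_distrib divide_inverse flip: cis_inverse)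
  then have "2 / (1 - w * cis (- t)) - 1 = 2 * \<zeta> / (\<zeta> - w) - 1" by simp
  also have "\<dots> = (\<zeta> + w) / (\<zeta> - w)"
    using ne by (simp add: divide_simps)
  finally have "2 / (1 - w * cis (- t)) - 1 = (\<zeta> + w) / (\<zeta> - w)" .
  moreover have "Re ((\<zeta> + w) / (\<zeta> - w)) = Re ((\<zeta> + w) * cnj (\<zeta> - w)) / (cmod (\<zeta> - w))\<^sup>2"
    by (simp add: complex_div_cnj[of "\<zeta> + w"] Re_divide_of_real flip: of_real_power)
  moreover have "Re ((\<zeta> + w) * cnj (\<zeta> - w)) = (cmod \<zeta>)\<^sup>2 - (cmod w)\<^sup>2"
    unfolding cmod_power2 by (simp add: power2_eq_square algebra_simps)
  ultimately show ?thesis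
    using \<zeta> by (simp add: poisson_kernel_def \<zeta>_def norm_minus_commute)
qed

definition disc_poisson :: "(complex \<Rightarrow> real) \<Rightarrow> complex \<Rightarrow> real" where
  "disc_poisson g w = 1 / (2*pi) * (\<integral>t. poisson_kernel w (cis t) * g (cis t) \<partial>angle_measure)"

text \<open>The kernel is the real part of \<open>2 / (1 - w / \<zeta>) - 1\<close>; expanding the geometric series and
  integrating termwise exhibits the Poisson integral as the real part of a power series whose
  coefficients are, up to constant factors, the Fourier coefficients of the data.\<close>

lemma disc_poisson_power_series:
  fixes g :: "complex \<Rightarrow> real"
  assumes g: "(\<lambda>t. g (cis t)) \<in> borel_measurable borel" and bd: "\<And>t. \<bar>g (cis t)\<bar> \<le> M"
  defines "b \<equiv> \<lambda>n. \<integral>t. of_real (g (cis t)) * cis (- t) ^ n \<partial>angle_measure"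
  assumes w: "cmod w < 1"
  obtains s where "(\<lambda>n. b n * w ^ n) sums s" "disc_poisson g w = Re (2 * s - b 0) / (2 * pi)"
proof -
  note [measurable] = g
  have M: "M \<ge> 0" using bd[of 0] by linarith
  define f where "f n t = of_real (g (cis t)) * (w * cis (- t)) ^ n" for n t
  have cis_minus [measurable]: "(\<lambda>t. cis (- t)) \<in> borel_measurable borel" by measurable
  have f_meas: "f n \<in> borel_measurable borel" for n unfolding f_def by measurable
  have f_norm: "norm (f n t) \<le> M * cmod w ^ n" for n t
    unfolding f_def by (auto simp: norm_mult norm_power bd intro!: mult_right_mono)
  have f_int: "integrable angle_measure (f n)" for n
    by (rule integrable_angle_bounded[OF f_meas f_norm])
  have geo: "summable (\<lambda>n. c * cmod w ^ n)" for c
    by (intro summable_mult summable_geometric) (simp add: w)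
  have f_summable: "summable (\<lambda>n. norm (f n t))" for t
    by (rule summable_comparison_test'[OF geo[of M], of 0]) (use f_norm in auto)
  have "(\<integral>t. norm (f n t) \<partial>angle_measure) \<le> 2 * pi * M * cmod w ^ n" for n
  proof -
    have "(\<integral>t. norm (f n t) \<partial>angle_measure) \<le> (\<integral>t. M * cmod w ^ n \<partial>angle_measure)"
      by (intro integral_mono integrable_norm f_int f_norm finite_measure.integrable_const
          finite_measure_angle)
    then show ?thesis by (simp add: lebesgue_integral_const mult_ac)
  qed
  then have summ: "summable (\<lambda>n. \<integral>t. norm (f n t) \<partial>angle_measure)"
    by (intro summable_comparison_test'[OF geo[of "2 * pi * M"], of 0]) auto
  define F where "F t = of_real (g (cis t)) * (1 / (1 - w * cis (- t)))" for t
  have f_sums: "(\<lambda>n. f n t) sums F t" for t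
    unfolding f_def F_def by (intro sums_mult geometric_sums) (simp add: norm_mult w)
  then have F_eq: "(\<Sum>n. f n t) = F t" for t by (simp add: sums_iff)
  have F_int: "integrable angle_measure F"
    using integrable_suminf[OF f_int _ summ] f_summable by (simp add: F_eq)
  have F_sums: "(\<lambda>n. integral\<^sup>L angle_measure (f n)) sums integral\<^sup>L angle_measure F"
    using sums_integral[OF f_int _ summ] f_summable by (simp add: F_eq)
  have f_b: "integral\<^sup>L angle_measure (f n) = b n * w ^ n" for n
  proof -
    have "f n = (\<lambda>t. (of_real (g (cis t)) * cis (- t) ^ n) * w ^ n)"
      by (simp add: fun_eq_iff f_def power_mult_distrib mult_ac)
    then show ?thesis unfolding b_def by simp
  qed
  show ?thesis
  proof (rule that)
    show "(\<lambda>n. b n * w ^ n) sums integral\<^sup>L angle_measure F" using F_sums by (simp add: f_b)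
    have "2 * integral\<^sup>L angle_measure F - b 0 = (\<integral>t. 2 * F t - f 0 t \<partial>angle_measure)"
      using F_int f_int[of 0] f_b[of 0] by simp
    also have "Re \<dots> = (\<integral>t. Re (2 * F t - f 0 t) \<partial>angle_measure)"
      using F_int f_int[of 0] by (subst integral_Re) auto
    also have "(\<lambda>t. Re (2 * F t - f 0 t)) = (\<lambda>t. poisson_kernel w (cis t) * g (cis t))"
    proof
      fix t
      have "2 * F t - f 0 t = of_real (g (cis t)) * (2 / (1 - w * cis (- t)) - 1)"
        by (simp add: F_def f_def algebra_simps)
      then show "Re (2 * F t - f 0 t) = poisson_kernel w (cis t) * g (cis t)"
        unfolding poisson_kernel_eq_Re[OF w] by (simp del: minus_complex.simps)
    qed
    finally show "disc_poisson g w = Re (2 * integral\<^sup>L angle_measure F - b 0) / (2 * pi)"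
      by (simp add: disc_poisson_def)
  qed
qed

lemma disc_poisson_eq_Re_holomorphic:
  fixes g :: "complex \<Rightarrow> real"
  assumes "(\<lambda>t. g (cis t)) \<in> borel_measurable borel" and "\<And>t. \<bar>g (cis t)\<bar> \<le> M"
  obtains F where "F holomorphic_on ball 0 1" "\<And>w. cmod w < 1 \<Longrightarrow> disc_poisson g w = Re (F w)"
proof -
  define b where "b n = (\<integral>t. of_real (g (cis t)) * cis (- t) ^ n \<partial>angle_measure)" for n
  have "\<exists>s. (\<lambda>n. b n * w ^ n) sums s \<and> disc_poisson g w = Re (2 * s - b 0) / (2 * pi)"
    if "cmod w < 1" for w
    unfolding b_def by (rule disc_poisson_power_series[OF assms that]) blast
  then obtain s where s: "\<And>w. cmod w < 1 \<Longrightarrow> (\<lambda>n. b n * w ^ n) sums s w"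
    "\<And>w. cmod w < 1 \<Longrightarrow> disc_poisson g w = Re (2 * s w - b 0) / (2 * pi)"
    by metis
  have "s holomorphic_on ball 0 1"
    by (rule power_series_holomorphic[where a = b]) (use s(1) in auto)
  then have "(\<lambda>w. (2 * s w - b 0) / of_real (2 * pi)) holomorphic_on ball 0 1"
    by (intro holomorphic_intros) auto
  moreover have "disc_poisson g w = Re ((2 * s w - b 0) / of_real (2 * pi))" if "cmod w < 1" for w
    using s(2)[OF that] by (simp only: Re_divide_of_real)
  ultimately show ?thesis by (rule that)
qed

lemma integral_cis_power:
  assumes "n > 0"
  shows "(\<integral>t. cis (- t) ^ n \<partial>angle_measure) = 0"
proof -
  define F where "F t = cis (- (real n * t)) / (- \<i> * of_nat n)" for t
  have deriv: "(F has_vector_derivative cis (- (real n * t))) (at t within S)" for t S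
  proof -
    have "((\<lambda>z. exp (- (\<i> * of_nat n * z)) / (- \<i> * of_nat n)) has_field_derivative
        exp (- (\<i> * of_nat n * of_real t))) (at (of_real t))"
      using assms by (auto intro!: derivative_eq_intros)
    from has_vector_derivative_real_field[OF this] show ?thesis
      unfolding F_def by (simp add: cis_conv_exp mult_ac)
  qed
  have "(\<integral>t. cis (- t) ^ n \<partial>angle_measure)
      = (\<integral>t. indicator {0..<2*pi} t *\<^sub>R cis (- (real n * t)) \<partial>lborel)"
    by (simp add: integral_angle Complex.DeMoivre)
  also have "\<dots> = (\<integral>t. indicator {0..2*pi} t *\<^sub>R cis (- (real n * t)) \<partial>lborel)"
  proof (rule integral_cong_AE)
    have "(\<lambda>t. cis (- (real n * t))) \<in> borel_measurable borel" by measurable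
    then show "(\<lambda>t. indicator {0..<2*pi} t *\<^sub>R cis (- (real n * t))) \<in> borel_measurable lborel"
      "(\<lambda>t. indicator {0..2*pi} t *\<^sub>R cis (- (real n * t))) \<in> borel_measurable lborel"
      by measurable
    show "AE t in lborel. indicator {0..<2*pi} t *\<^sub>R cis (- (real n * t))
        = indicator {0..2*pi} t *\<^sub>R cis (- (real n * t))"
      using AE_lborel_singleton[of "2 * pi"] by eventually_elim (auto simp: indicator_def)
  qed
  also have "\<dots> = F (2 * pi) - F 0"
    by (rule integral_FTC_Icc[OF _ deriv]) (auto intro!: continuous_intros)
  also have "F (2 * pi) = F 0"
    using cis_multiple_2pi[of "- real n"] by (simp add: F_def mult_ac)
  finally show ?thesis by simp
qed

lemma integral_poisson_kernel:
  assumes "cmod w < 1"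
  shows "(\<integral>t. poisson_kernel w (cis t) \<partial>angle_measure) = 2 * pi"
proof -
  define b where "b n = (\<integral>t. of_real 1 * cis (- t) ^ n \<partial>angle_measure)" for n
  have b: "b n = (if n = 0 then 2 * pi else 0)" for n
    unfolding b_def using integral_cis_power[of n]
    by (auto simp: lebesgue_integral_const scaleR_conv_of_real)
  obtain s where s: "(\<lambda>n. b n * w ^ n) sums s" "disc_poisson (\<lambda>_. 1) w = Re (2 * s - b 0) / (2 * pi)"
    using disc_poisson_power_series[of "\<lambda>_. 1" 1 w] assms unfolding b_def by auto
  have "(\<lambda>n. b n * w ^ n) = (\<lambda>n. if n = 0 then complex_of_real (2 * pi) else 0)" by (auto simp: b)
  then have "(\<lambda>n. b n * w ^ n) sums (2 * pi)"
    using sums_single[of 0 "\<lambda>_. complex_of_real (2 * pi)"] by simp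
  with s(1) have "s = 2 * pi" by (rule sums_unique2)
  then show ?thesis using s(2) b[of 0] by (simp add: disc_poisson_def)
qed

lemma integrable_poisson_kernel_mult:
  assumes w: "cmod w \<le> 1"
    and g: "(\<lambda>t. g (cis t)) \<in> borel_measurable borel" and bd: "\<And>t. \<bar>g (cis t)\<bar> \<le> M"
  shows "integrable angle_measure (\<lambda>t. poisson_kernel w (cis t) * g (cis t))"
proof -
  obtain B where B: "B \<ge> 0" "\<And>\<zeta>. cmod \<zeta> = 1 \<Longrightarrow> \<bar>poisson_kernel w \<zeta>\<bar> \<le> B"
    using poisson_kernel_bound[OF w] by blast
  note [measurable] = g
  show ?thesis
  proof (rule integrable_angle_bounded)
    show "(\<lambda>t. poisson_kernel w (cis t) * g (cis t)) \<in> borel_measurable borel"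
      unfolding poisson_kernel_def by measurable
    show "norm (poisson_kernel w (cis t) * g (cis t)) \<le> B * M" for t
      using B(1) B(2)[of "cis t"] bd[of t] by (auto simp: abs_mult intro!: mult_mono)
  qed
qed

lemma integrable_poisson_kernel:
  "cmod w \<le> 1 \<Longrightarrow> integrable angle_measure (\<lambda>t. poisson_kernel w (cis t))"
  using integrable_poisson_kernel_mult[of w "\<lambda>_. 1" 1] by simp

lemma integral_poisson_kernel_le:
  assumes "cmod w \<le> 1"
  shows "(\<integral>t. poisson_kernel w (cis t) \<partial>angle_measure) \<le> 2 * pi"
  using assms integral_poisson_kernel[of w]
  by (cases "cmod w = 1") (auto simp: poisson_kernel_eq_0)

lemma abs_disc_poisson_le:
  assumes w: "cmod w \<le> 1"
    and g: "(\<lambda>t. g (cis t)) \<in> borel_measurable borel" and bd: "\<And>t. \<bar>g (cis t)\<bar> \<le> M"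
  shows "\<bar>disc_poisson g w\<bar> \<le> M"
proof -
  have M: "M \<ge> 0" using bd[of 0] by linarith
  have "\<bar>\<integral>t. poisson_kernel w (cis t) * g (cis t) \<partial>angle_measure\<bar>
      \<le> (\<integral>t. \<bar>poisson_kernel w (cis t) * g (cis t)\<bar> \<partial>angle_measure)"
    by (rule integral_abs_bound)
  also have "\<dots> \<le> (\<integral>t. poisson_kernel w (cis t) * M \<partial>angle_measure)"
    using integrable_poisson_kernel_mult[OF w g bd] integrable_poisson_kernel[OF w]
      poisson_kernel_nonneg[OF w] bd
    by (intro integral_mono integrable_abs integrable_mult_left) (auto simp: abs_mult mult_left_mono)
  also have "\<dots> \<le> 2 * pi * M"
    using integral_poisson_kernel_le[OF w] M by (simp add: mult_right_mono)
  finally show ?thesis by (simp add: disc_poisson_def abs_mult field_simps)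
qed

text \<open>The classical argument of Schwarz: near \<open>\<zeta>0\<close> the data differ from \<open>g \<zeta>0\<close> by at most \<open>\<epsilon>\<close>,
  and away from \<open>\<zeta>0\<close> the kernel is at most a constant times \<open>1 - |w|\<^sup>2\<close>.\<close>

lemma disc_poisson_tendsto:
  assumes g: "(\<lambda>t. g (cis t)) \<in> borel_measurable borel" and bd: "\<And>t. \<bar>g (cis t)\<bar> \<le> M"
    and \<zeta>0: "cmod \<zeta>0 = 1" and cont: "(g \<longlongrightarrow> g \<zeta>0) (at \<zeta>0 within sphere 0 1)"
  shows "(disc_poisson g \<longlongrightarrow> g \<zeta>0) (at \<zeta>0 within ball 0 1)"
proof (rule tendstoI)
  fix e :: real assume e: "e > 0"
  define \<epsilon> where "\<epsilon> = e / 2"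
  have \<epsilon>: "\<epsilon> > 0" using e by (simp add: \<epsilon>_def)
  obtain d where d: "d > 0"
    and near: "\<And>\<zeta>. cmod \<zeta> = 1 \<Longrightarrow> dist \<zeta> \<zeta>0 < d \<Longrightarrow> \<bar>g \<zeta> - g \<zeta>0\<bar> \<le> \<epsilon>"
  proof -
    obtain d where "d > 0" "\<And>\<zeta>. \<zeta> \<in> sphere 0 1 \<Longrightarrow> \<zeta> \<noteq> \<zeta>0 \<Longrightarrow> dist \<zeta> \<zeta>0 < d \<Longrightarrow> dist (g \<zeta>) (g \<zeta>0) < \<epsilon>"
      using tendstoD[OF cont \<epsilon>] unfolding eventually_at by blast
    then show ?thesis
      using \<epsilon> by (intro that[of d]) (auto simp: dist_real_def, metis abs_zero diff_self less_eq_real_def)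
  qed
  have far: "\<bar>g (cis t) - g \<zeta>0\<bar> \<le> 2 * M" for t
  proof -
    obtain t0 where "\<zeta>0 = cis t0" using \<zeta>0 by (metis cis_Arg norm_zero zero_neq_one sgn_div_norm inverse_1 scaleR_one)
    then show ?thesis using bd[of t] bd[of t0] by simp
  qed
  have M: "M \<ge> 0" using bd[of 0] by linarith
  define C where "C = 2 * M * 4 / d\<^sup>2"
  have est: "\<bar>disc_poisson g w - g \<zeta>0\<bar> \<le> \<epsilon> + C * (1 - (cmod w)\<^sup>2)"
    if w: "cmod w < 1" and wd: "dist w \<zeta>0 < d / 2" for w
  proof -
    have w1: "cmod w \<le> 1" using w by simp
    have c0: "C * (1 - (cmod w)\<^sup>2) \<ge> 0" using M w by (simp add: C_def power_le_one)
    have pt: "poisson_kernel w (cis t) * \<bar>g (cis t) - g \<zeta>0\<bar>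
        \<le> poisson_kernel w (cis t) * \<epsilon> + C * (1 - (cmod w)\<^sup>2)" for t
    proof (cases "dist (cis t) \<zeta>0 < d")
      case True
      then show ?thesis
        using near[of "cis t"] poisson_kernel_nonneg[OF w1] c0
        by (intro add_increasing2) (auto intro!: mult_left_mono)
    next
      case False
      then have "dist w (cis t) \<ge> d / 2"
        using wd dist_triangle[of "cis t" \<zeta>0 w] by (simp add: dist_commute)
      then have "poisson_kernel w (cis t) \<le> (1 - (cmod w)\<^sup>2) / (d / 2)\<^sup>2"
        using d by (intro poisson_kernel_le[OF w1]) (auto simp: dist_norm)
      then have "poisson_kernel w (cis t) * \<bar>g (cis t) - g \<zeta>0\<bar>
          \<le> (1 - (cmod w)\<^sup>2) / (d / 2)\<^sup>2 * (2 * M)"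
        using far poisson_kernel_nonneg[OF w1] w by (intro mult_mono) (auto simp: power_le_one)
      also have "\<dots> = C * (1 - (cmod w)\<^sup>2)" by (simp add: C_def power2_eq_square)
      finally show ?thesis using poisson_kernel_nonneg[OF w1] \<epsilon> by (simp add: add_increasing)
    qed
    have int1: "integrable angle_measure (\<lambda>t. poisson_kernel w (cis t) * g (cis t))"
      by (rule integrable_poisson_kernel_mult[OF w1 g bd])
    note int2 = integrable_poisson_kernel[OF w1]
    have int3: "integrable angle_measure (\<lambda>t. poisson_kernel w (cis t) * (g (cis t) - g \<zeta>0))"
      using int1 int2 by (simp add: right_diff_distrib)
    have "2 * pi * (disc_poisson g w - g \<zeta>0)
        = (\<integral>t. poisson_kernel w (cis t) * (g (cis t) - g \<zeta>0) \<partial>angle_measure)"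
      using int1 int2 integral_poisson_kernel[OF w]
      by (simp add: disc_poisson_def right_diff_distrib)
    also have "\<bar>\<dots>\<bar> \<le> (\<integral>t. \<bar>poisson_kernel w (cis t) * (g (cis t) - g \<zeta>0)\<bar> \<partial>angle_measure)"
      by (rule integral_abs_bound)
    also have "\<dots> \<le> (\<integral>t. poisson_kernel w (cis t) * \<epsilon> + C * (1 - (cmod w)\<^sup>2) \<partial>angle_measure)"
    proof (rule integral_mono)
      show "integrable angle_measure (\<lambda>t. \<bar>poisson_kernel w (cis t) * (g (cis t) - g \<zeta>0)\<bar>)"
        using int3 by (rule integrable_abs)
      show "integrable angle_measure (\<lambda>t. poisson_kernel w (cis t) * \<epsilon> + C * (1 - (cmod w)\<^sup>2))"
        using int2 finite_measure.integrable_const[OF finite_measure_angle]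
        by (intro Bochner_Integration.integrable_add integrable_mult_left) auto
    qed (use pt poisson_kernel_nonneg[OF w1] in \<open>simp add: abs_mult\<close>)
    also have "\<dots> = 2 * pi * (\<epsilon> + C * (1 - (cmod w)\<^sup>2))"
      using int2 finite_measure.integrable_const[OF finite_measure_angle] integral_poisson_kernel[OF w]
      by (subst Bochner_Integration.integral_add) (auto simp: lebesgue_integral_const algebra_simps)
    finally show ?thesis by (simp add: abs_mult)
  qed
  have "((\<lambda>w. \<epsilon> + C * (1 - (cmod w)\<^sup>2)) \<longlongrightarrow> \<epsilon> + C * (1 - (cmod \<zeta>0)\<^sup>2)) (at \<zeta>0 within ball 0 1)"
    by (intro tendsto_intros)
  then have lim: "((\<lambda>w. \<epsilon> + C * (1 - (cmod w)\<^sup>2)) \<longlongrightarrow> \<epsilon>) (at \<zeta>0 within ball 0 1)"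
    by (simp add: \<zeta>0)
  have "eventually (\<lambda>w. \<epsilon> + C * (1 - (cmod w)\<^sup>2) < e) (at \<zeta>0 within ball 0 1)"
    using order_tendstoD(2)[OF lim, of e] e by (simp add: \<epsilon>_def)
  moreover have "eventually (\<lambda>w. w \<in> ball 0 1 \<and> dist w \<zeta>0 < d / 2) (at \<zeta>0 within ball 0 1)"
    unfolding eventually_at using d by (intro exI[of _ "d / 2"]) auto
  ultimately show "eventually (\<lambda>w. dist (disc_poisson g w) (g \<zeta>0) < e) (at \<zeta>0 within ball 0 1)"
  proof eventually_elim
    case (elim w)
    then show ?case using est[of w] by (simp add: dist_real_def)
  qed
qed

section \<open>Transplanting Poisson integrals by an extended Riemann map\<close>

text \<open>If \<open>h\<close> tends to \<open>c\<close> at every point over \<open>q\<close>, the points where \<open>h\<close> is not close to \<open>c\<close> do not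
  accumulate there, so their closure is a compact set whose image is closed and misses \<open>q\<close>.\<close>

lemma tendsto_pushforward:
  fixes \<phi> :: "'a :: metric_space \<Rightarrow> 'b :: metric_space" and h :: "'a \<Rightarrow> 'c :: metric_space"
  assumes K: "compact K" "continuous_on K \<phi>" "S \<subseteq> K"
    and lim: "\<And>\<zeta>. \<zeta> \<in> K \<Longrightarrow> \<phi> \<zeta> = q \<Longrightarrow> (h \<longlongrightarrow> c) (at \<zeta> within S)"
    and lift: "\<And>z. z \<in> T \<Longrightarrow> z \<noteq> q \<Longrightarrow> \<exists>w\<in>S. \<phi> w = z \<and> k z = h w"
  shows "(k \<longlongrightarrow> c) (at q within T)"
proof (rule tendstoI)
  fix e :: real assume e: "e > 0"
  define N where "N = {w\<in>S. \<phi> w \<noteq> q \<and> \<not> dist (h w) c < e}"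
  have "closure N \<subseteq> K"
    by (rule closure_minimal) (use K in \<open>auto simp: N_def compact_imp_closed\<close>)
  then have "compact (closure N)" "continuous_on (closure N) \<phi>"
    using K compact_Int_closed[OF K(1), of "closure N"] continuous_on_subset[OF K(2)]
    by (auto simp: Int_absorb1)
  then have closed: "closed (\<phi> ` closure N)"
    by (intro compact_imp_closed compact_continuous_image)
  have "q \<notin> \<phi> ` closure N"
  proof
    assume "q \<in> \<phi> ` closure N"
    then obtain \<zeta> where \<zeta>: "\<zeta> \<in> closure N" "\<phi> \<zeta> = q" by blast
    then have "\<zeta> islimpt N" by (auto simp: closure_def N_def)
    moreover have "eventually (\<lambda>_. False) (at \<zeta> within N)"
    proof -
      have "eventually (\<lambda>w. dist (h w) c < e) (at \<zeta> within S)"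
        using lim[of \<zeta>] \<zeta> \<open>closure N \<subseteq> K\<close> e by (blast intro: tendstoD)
      then show ?thesis
        unfolding eventually_at_filter by eventually_elim (auto simp: N_def)
    qed
    ultimately show False by (simp add: eventually_False trivial_limit_within)
  qed
  then have "eventually (\<lambda>z. z \<notin> \<phi> ` closure N) (at q within T)"
    using closed by (intro eventually_at_topological[THEN iffD2] exI[of _ "- (\<phi> ` closure N)"]) auto
  moreover have "eventually (\<lambda>z. z \<in> T \<and> z \<noteq> q) (at q within T)"
    by (auto simp: eventually_at_filter)
  ultimately show "eventually (\<lambda>z. dist (k z) c < e) (at q within T)"
  proof eventually_elim
    case (elim z)
    then obtain w where w: "w \<in> S" "\<phi> w = z" "k z = h w" using lift by blast
    then have "w \<notin> N" using elim(1) closure_subset[of N] by blast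
    then show ?case using w elim by (auto simp: N_def)
  qed
qed

lemma extended_riemann_mapD:
  assumes "extended_riemann_map \<phi> G"
  shows "continuous_on (cball 0 1) \<phi>" "\<phi> ` cball 0 1 = closure G" "\<phi> holomorphic_on ball 0 1"
    "inj_on \<phi> (ball 0 1)" "\<phi> ` ball 0 1 = G"
  using assms by (auto simp: extended_riemann_map_def)

text \<open>If a boundary point were mapped into \<open>G\<close>, continuity of the inverse on \<open>G\<close> would put it into
  the open disc.\<close>

lemma extended_riemann_map_sphere_notin:
  assumes \<phi>: "extended_riemann_map \<phi> G" and "open G" and \<zeta>: "\<zeta> \<in> sphere 0 1"
  shows "\<phi> \<zeta> \<notin> G"
proof
  assume G: "\<phi> \<zeta> \<in> G"
  note \<phi>D = extended_riemann_mapD[OF \<phi>]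
  obtain g where g: "g holomorphic_on (\<phi> ` ball 0 1)" "\<And>z. z \<in> ball 0 1 \<Longrightarrow> g (\<phi> z) = z"
    using holomorphic_has_inverse[OF \<phi>D(3) open_ball \<phi>D(4)] by metis
  have "isCont g (\<phi> \<zeta>)"
    using holomorphic_on_imp_continuous_on[OF g(1)] G \<open>open G\<close>
    unfolding \<phi>D(5) by (simp add: continuous_on_eq_continuous_at)
  moreover have "(\<phi> \<longlongrightarrow> \<phi> \<zeta>) (at \<zeta> within ball 0 1)"
  proof (rule tendsto_within_subset)
    show "(\<phi> \<longlongrightarrow> \<phi> \<zeta>) (at \<zeta> within cball 0 1)"
      using \<phi>D(1) \<zeta> by (auto simp: continuous_on_def)
  qed auto
  ultimately have "((\<lambda>w. g (\<phi> w)) \<longlongrightarrow> g (\<phi> \<zeta>)) (at \<zeta> within ball 0 1)"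
    by (rule isCont_tendsto_compose)
  moreover have "((\<lambda>w. g (\<phi> w)) \<longlongrightarrow> \<zeta>) (at \<zeta> within ball 0 1)"
    by (rule Lim_transform_eventually[OF tendsto_ident_at])
      (auto simp: eventually_at_filter g(2))
  moreover have "at \<zeta> within ball 0 1 \<noteq> bot"
    using \<zeta> islimpt_ball[of \<zeta> 0 1] by (simp add: trivial_limit_within)
  ultimately have "g (\<phi> \<zeta>) = \<zeta>" by (rule tendsto_unique[rotated])
  moreover have "g (\<phi> \<zeta>) \<in> ball 0 1"
    using G g(2) unfolding \<phi>D(5)[symmetric] by auto
  ultimately show False using \<zeta> by simp
qed

lemma extended_riemann_map_sphere:
  assumes \<phi>: "extended_riemann_map \<phi> G" and "open G" and \<zeta>: "\<zeta> \<in> sphere 0 1"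
  shows "\<phi> \<zeta> \<in> frontier G"
proof -
  have "\<phi> \<zeta> \<in> closure G" using extended_riemann_mapD(2)[OF \<phi>] \<zeta> by auto
  then show ?thesis
    using extended_riemann_map_sphere_notin[OF assms] \<open>open G\<close>
    by (simp add: frontier_def interior_open)
qed

lemma disc_inv_closure:
  assumes "extended_riemann_map \<phi> G" "z \<in> closure G"
  shows "disc_inv \<phi> z \<in> cball 0 1" "\<phi> (disc_inv \<phi> z) = z"
  using assms inv_into_into[of z \<phi> "cball 0 1"] f_inv_into_f[of z \<phi> "cball 0 1"]
    extended_riemann_mapD(2)[OF assms(1)]
  by (auto simp: disc_inv_def)

lemma disc_inv_ball:
  assumes "extended_riemann_map \<phi> G" "open G" "z \<in> G"
  shows "disc_inv \<phi> z \<in> ball 0 1" "\<phi> (disc_inv \<phi> z) = z"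
proof -
  have z: "z \<in> closure G" using assms(3) closure_subset by blast
  note disc_inv_closure[OF assms(1) z]
  then show "disc_inv \<phi> z \<in> ball 0 1" "\<phi> (disc_inv \<phi> z) = z"
    using extended_riemann_map_sphere_notin[OF assms(1,2), of "disc_inv \<phi> z"] assms(3)
    by (auto simp: less_eq_real_def)
qed

lemma disc_inv_holomorphic:
  assumes \<phi>: "extended_riemann_map \<phi> G" and "open G"
  shows "disc_inv \<phi> holomorphic_on G"
proof -
  note \<phi>D = extended_riemann_mapD[OF \<phi>]
  obtain g where g: "g holomorphic_on (\<phi> ` ball 0 1)" "\<And>z. z \<in> ball 0 1 \<Longrightarrow> g (\<phi> z) = z"
    using holomorphic_has_inverse[OF \<phi>D(3) open_ball \<phi>D(4)] by metis
  have "g z = disc_inv \<phi> z" if "z \<in> G" for z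
    using g(2)[OF disc_inv_ball(1)[OF \<phi> \<open>open G\<close> that]] disc_inv_ball(2)[OF \<phi> \<open>open G\<close> that]
    by simp
  then show ?thesis
    using g(1) unfolding \<phi>D(5) by (rule holomorphic_transform[rotated])
qed

lemma circle_integral_eq:
  "circle_integral A g = (\<integral>t. indicator A (cis t) * g (cis t) \<partial>angle_measure)"
  unfolding circle_integral_def set_lebesgue_integral_def integral_angle
  by (rule Bochner_Integration.integral_cong) (auto simp: indicator_def)

lemma indicator_disc_preimage:
  "indicator (disc_preimage \<phi> S) (cis t) = (indicator S (\<phi> (cis t)) :: real)"
  by (simp add: disc_preimage_def indicator_def)

lemma poisson_integral_eq_disc_poisson:
  "poisson_integral \<phi> S g z = disc_poisson (\<lambda>\<zeta>. indicator S (\<phi> \<zeta>) * g (\<phi> \<zeta>)) (disc_inv \<phi> z)"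
  unfolding poisson_integral_def circle_integral_eq disc_poisson_def indicator_disc_preimage
  by (simp add: mult_ac)

lemma poisson_integral_UNIV:
  "poisson_integral \<phi> UNIV k z = disc_poisson (\<lambda>\<zeta>. k (\<phi> \<zeta>)) (disc_inv \<phi> z)"
  by (simp add: poisson_integral_eq_disc_poisson)

lemma extended_riemann_map_measurable:
  assumes "extended_riemann_map \<phi> G"
  shows "(\<lambda>t. \<phi> (cis t)) \<in> borel_measurable borel"
  by (intro borel_measurable_continuous_onI
      continuous_on_compose2[OF extended_riemann_mapD(1)[OF assms]] continuous_intros) auto

lemma measurable_compose_riemann_map:
  assumes "extended_riemann_map \<phi> G" "k \<in> borel_measurable borel"
  shows "(\<lambda>t. k (\<phi> (cis t))) \<in> borel_measurable borel"
  using measurable_compose[OF extended_riemann_map_measurable[OF assms(1)] assms(2)] by simp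

lemma poisson_integral_UNIV_add:
  assumes \<phi>: "extended_riemann_map \<phi> G" and z: "z \<in> closure G"
    and k: "k \<in> borel_measurable borel" "\<And>x. \<bar>k x\<bar> \<le> M"
    and l: "l \<in> borel_measurable borel" "\<And>x. \<bar>l x\<bar> \<le> N"
  shows "poisson_integral \<phi> UNIV k z + poisson_integral \<phi> UNIV l z
    = poisson_integral \<phi> UNIV (\<lambda>x. k x + l x) z"
proof -
  have w: "cmod (disc_inv \<phi> z) \<le> 1" using disc_inv_closure(1)[OF \<phi> z] by simp
  have "integrable angle_measure (\<lambda>t. poisson_kernel (disc_inv \<phi> z) (cis t) * k (\<phi> (cis t)))"
    by (rule integrable_poisson_kernel_mult[OF w]) (use measurable_compose_riemann_map[OF \<phi>] k in auto)
  moreover have "integrable angle_measure (\<lambda>t. poisson_kernel (disc_inv \<phi> z) (cis t) * l (\<phi> (cis t)))"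
    by (rule integrable_poisson_kernel_mult[OF w]) (use measurable_compose_riemann_map[OF \<phi>] l in auto)
  ultimately show ?thesis
    by (simp add: poisson_integral_UNIV disc_poisson_def distrib_left add_divide_distrib)
qed

lemma abs_poisson_integral_le:
  assumes \<phi>: "extended_riemann_map \<phi> G" and z: "z \<in> closure G"
    and k: "k \<in> borel_measurable borel" "\<And>x. \<bar>k x\<bar> \<le> M"
  shows "\<bar>poisson_integral \<phi> UNIV k z\<bar> \<le> M"
  unfolding poisson_integral_UNIV
  by (rule abs_disc_poisson_le)
    (use disc_inv_closure(1)[OF \<phi> z] measurable_compose_riemann_map[OF \<phi> k(1)] k(2) in auto)

lemma harmonic_on_poisson_integral:
  assumes \<phi>: "extended_riemann_map \<phi> G" and "open G"
    and k: "k \<in> borel_measurable borel" "\<And>x. \<bar>k x\<bar> \<le> M"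
  shows "harmonic_on (poisson_integral \<phi> UNIV k) G"
proof -
  obtain F where F: "F holomorphic_on ball 0 1"
    "\<And>w. cmod w < 1 \<Longrightarrow> disc_poisson (\<lambda>\<zeta>. k (\<phi> \<zeta>)) w = Re (F w)"
    using disc_poisson_eq_Re_holomorphic[OF measurable_compose_riemann_map[OF \<phi> k(1)] k(2)] by metis
  have "(F \<circ> disc_inv \<phi>) holomorphic_on G"
    by (rule holomorphic_on_compose_gen[OF disc_inv_holomorphic[OF \<phi> \<open>open G\<close>] F(1)])
      (use disc_inv_ball[OF \<phi> \<open>open G\<close>] in auto)
  from harmonic_on_Re_holomorphic[OF this \<open>open G\<close>] show ?thesis
    by (rule harmonic_on_cong)
      (use disc_inv_ball[OF \<phi> \<open>open G\<close>] in \<open>auto simp: poisson_integral_UNIV F(2)\<close>)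
qed

theorem poisson_integral_tendsto:
  assumes \<phi>: "extended_riemann_map \<phi> G" and "open G"
    and k: "k \<in> borel_measurable borel" "\<And>x. \<bar>k x\<bar> \<le> M"
    and q: "q \<notin> G" and cont: "(k \<longlongrightarrow> k q) (at q within frontier G)"
  shows "(poisson_integral \<phi> UNIV k \<longlongrightarrow> k q) (at q within G)"
proof (rule tendsto_pushforward)
  note \<phi>D = extended_riemann_mapD[OF \<phi>]
  show "compact (cball 0 1 :: complex set)" "continuous_on (cball 0 1) \<phi>" 
    "ball 0 1 \<subseteq> (cball 0 1 :: complex set)"
    using \<phi>D by auto
  fix \<zeta> :: complex assume \<zeta>: "\<zeta> \<in> cball 0 1" "\<phi> \<zeta> = q"
  then have \<zeta>1: "cmod \<zeta> = 1" using q \<phi>D(5) by force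
  have "(\<phi> \<longlongrightarrow> q) (at \<zeta> within cball 0 1)"
    using \<phi>D(1) \<zeta> by (auto simp: continuous_on_def)
  then have lim: "(\<phi> \<longlongrightarrow> q) (at \<zeta> within sphere 0 1)"
    by (rule tendsto_within_subset) auto
  have cont': "eventually (\<lambda>x. x \<in> frontier G \<longrightarrow> dist (k x) (k q) < e) (nhds q)" if "e > 0" for e
  proof -
    have "eventually (\<lambda>x. x \<noteq> q \<longrightarrow> x \<in> frontier G \<longrightarrow> dist (k x) (k q) < e) (nhds q)"
      using tendstoD[OF cont that] by (simp add: eventually_at_filter)
    then show ?thesis by eventually_elim (use that in auto)
  qed
  have "((\<lambda>\<zeta>. k (\<phi> \<zeta>)) \<longlongrightarrow> k (\<phi> \<zeta>)) (at \<zeta> within sphere 0 1)"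
  proof (rule tendstoI)
    fix e :: real assume "e > 0"
    from eventually_compose_filterlim[OF cont'[OF this] lim]
    show "eventually (\<lambda>x. dist (k (\<phi> x)) (k (\<phi> \<zeta>)) < e) (at \<zeta> within sphere 0 1)"
      unfolding eventually_at_filter
      by eventually_elim (use extended_riemann_map_sphere[OF \<phi> \<open>open G\<close>] \<zeta> in auto)
  qed
  then show "(disc_poisson (\<lambda>\<zeta>. k (\<phi> \<zeta>)) \<longlongrightarrow> k q) (at \<zeta> within ball 0 1)"
    using disc_poisson_tendsto[OF measurable_compose_riemann_map[OF \<phi> k(1)] k(2) \<zeta>1] \<zeta>(2) by simp
next
  fix z assume "z \<in> G"
  then show "\<exists>w\<in>ball 0 1. \<phi> w = z \<and> poisson_integral \<phi> UNIV k z = disc_poisson (\<lambda>\<zeta>. k (\<phi> \<zeta>)) w"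
    using disc_inv_ball[OF \<phi> \<open>open G\<close>] by (intro bexI[of _ "disc_inv \<phi> z"]) (auto simp: poisson_integral_UNIV)
qed

section \<open>Interchanging two Poisson integrations\<close>

text \<open>The points \<open>w t\<close> may approach the unit circle, where the kernel is unbounded; but the kernel is
  nonnegative and its total integral is at most \<open>2\<pi>\<close>, uniformly in \<open>w t\<close>, which makes the
  integrand absolutely integrable on the square.\<close>

lemma Fubini_poisson:
  fixes a b :: "real \<Rightarrow> real" and w :: "real \<Rightarrow> complex"
  assumes a: "a \<in> borel_measurable borel" "\<And>t. \<bar>a t\<bar> \<le> A"
    and b: "b \<in> borel_measurable borel" "\<And>t. \<bar>b t\<bar> \<le> B"
    and w: "w \<in> borel_measurable borel" "\<And>t. cmod (w t) \<le> 1"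
  shows "(\<integral>s. (\<integral>t. a t * poisson_kernel (w t) (cis s) \<partial>angle_measure) * b s \<partial>angle_measure)
    = (\<integral>t. a t * (\<integral>s. poisson_kernel (w t) (cis s) * b s \<partial>angle_measure) \<partial>angle_measure)"
proof -
  interpret finite_measure angle_measure by (rule finite_measure_angle)
  interpret pair_sigma_finite angle_measure angle_measure ..
  have A: "A \<ge> 0" and B: "B \<ge> 0" using a(2)[of 0] b(2)[of 0] by linarith+
  define f where "f t s = a t * poisson_kernel (w t) (cis s) * b s" for t s
  have id: "(\<lambda>x. x) \<in> measurable angle_measure borel" by (rule measurable_angle) simp
  have fst_m: "fst \<in> measurable (angle_measure \<Otimes>\<^sub>M angle_measure) borel"
    and snd_m: "snd \<in> measurable (angle_measure \<Otimes>\<^sub>M angle_measure) borel"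
    using measurable_compose[OF measurable_fst id] measurable_compose[OF measurable_snd id] by auto
  have [measurable]: "(\<lambda>p. a (fst p)) \<in> borel_measurable (angle_measure \<Otimes>\<^sub>M angle_measure)"
    "(\<lambda>p. w (fst p)) \<in> borel_measurable (angle_measure \<Otimes>\<^sub>M angle_measure)"
    "(\<lambda>p. b (snd p)) \<in> borel_measurable (angle_measure \<Otimes>\<^sub>M angle_measure)"
    "(\<lambda>p. cis (snd p)) \<in> borel_measurable (angle_measure \<Otimes>\<^sub>M angle_measure)"
    using measurable_compose[OF fst_m a(1)] measurable_compose[OF fst_m w(1)]
      measurable_compose[OF snd_m b(1)] measurable_compose[OF snd_m borel_measurable_cis] by auto
  have f_eq: "case_prod f = (\<lambda>p. a (fst p) * poisson_kernel (w (fst p)) (cis (snd p)) * b (snd p))"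
    by (auto simp: f_def)
  have f_meas: "case_prod f \<in> borel_measurable (angle_measure \<Otimes>\<^sub>M angle_measure)"
    unfolding f_eq by measurable
  have f_int: "integrable angle_measure (f t)" for t
  proof -
    obtain C where C: "C \<ge> 0" "\<And>\<zeta>. cmod \<zeta> = 1 \<Longrightarrow> \<bar>poisson_kernel (w t) \<zeta>\<bar> \<le> C"
      using poisson_kernel_bound[OF w(2)] by blast
    note [measurable] = b(1)
    show ?thesis
    proof (rule integrable_angle_bounded)
      show "f t \<in> borel_measurable borel" unfolding f_def by measurable
      show "norm (f t s) \<le> A * C * B" for s
        unfolding f_def using A B C(1) a(2)[of t] b(2)[of s] C(2)[of "cis s"]
        by (auto simp: abs_mult intro!: mult_mono)
    qed
  qed
  have "norm (\<integral>s. norm (f t s) \<partial>angle_measure) \<le> A * (2 * pi) * B" for t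
  proof -
    have "(\<integral>s. norm (f t s) \<partial>angle_measure)
        \<le> (\<integral>s. A * poisson_kernel (w t) (cis s) * B \<partial>angle_measure)"
      using f_int[of t, unfolded f_def] integrable_poisson_kernel[OF w(2)[of t]] a(2)[of t] b(2) A B
        poisson_kernel_nonneg[OF w(2)[of t]]
      by (intro integral_mono integrable_norm integrable_mult_left integrable_mult_right)
        (auto simp: f_def abs_mult intro!: mult_mono)
    also have "\<dots> \<le> A * (2 * pi) * B"
      using integral_poisson_kernel_le[OF w(2)[of t]] A B
      by (auto intro!: mult_right_mono mult_left_mono)
    finally show ?thesis by simp
  qed
  moreover have "(\<lambda>t. \<integral>s. norm (f t s) \<partial>angle_measure) \<in> borel_measurable angle_measure"
    using f_meas by measurable
  ultimately have "integrable angle_measure (\<lambda>t. \<integral>s. norm (f t s) \<partial>angle_measure)"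
    by (intro integrable_const_bound) auto
  then have "integrable (angle_measure \<Otimes>\<^sub>M angle_measure) (case_prod f)"
    using f_int by (intro Fubini_integrable f_meas) auto
  note Fubini_integral[OF this]
  moreover have "(\<integral>t. f t s \<partial>angle_measure)
      = (\<integral>t. a t * poisson_kernel (w t) (cis s) \<partial>angle_measure) * b s" for s
    unfolding f_def by simp
  moreover have "(\<integral>s. f t s \<partial>angle_measure)
      = a t * (\<integral>s. poisson_kernel (w t) (cis s) * b s \<partial>angle_measure)" for t
    unfolding f_def mult.assoc by simp
  ultimately show ?thesis by simp
qed

section \<open>Functions with finitely many exceptional points\<close>

lemma measurable_indicator_continuous_off_finite:
  fixes g :: "complex \<Rightarrow> 'b :: real_normed_vector"
  assumes "S \<in> sets borel" "finite E" "continuous_on (S - E) g"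
  shows "(\<lambda>x. indicator S x *\<^sub>R g x) \<in> borel_measurable borel"
proof -
  have "S - E \<in> sets borel"
    using assms(1,2) by (intro sets.Diff) (auto intro: borel_closed finite_imp_closed)
  then have "(\<lambda>x. indicator (S - E) x *\<^sub>R g x) \<in> borel_measurable borel"
    using assms(3) by (rule borel_measurable_continuous_on_indicator)
  then show ?thesis
    by (rule measurable_discrete_difference[where X = E])
      (use assms(2) in \<open>auto simp: countable_finite indicator_def\<close>)
qed

corollary measurable_indicator_mult_continuous_off_finite:
  fixes g :: "complex \<Rightarrow> real"
  assumes "S \<in> sets borel" "finite E" "continuous_on (S - E) g"
  shows "(\<lambda>x. indicator S x * g x) \<in> borel_measurable borel"
  using measurable_indicator_continuous_off_finite[OF assms] by simp

lemma bounded_indicator_off_finite: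
  fixes g :: "complex \<Rightarrow> real"
  assumes "finite E" "\<And>x. x \<in> S - E \<Longrightarrow> \<bar>g x\<bar> \<le> M"
  shows "\<exists>N. \<forall>x. \<bar>indicator S x * g x\<bar> \<le> N"
proof -
  have "bounded (insert 0 (g ` E \<union> {-M..M}))"
    using assms(1) by (auto simp: bounded_insert finite_imp_bounded)
  then obtain N where N: "\<And>y. y \<in> insert 0 (g ` E \<union> {-M..M}) \<Longrightarrow> \<bar>y\<bar> \<le> N"
    unfolding bounded_iff real_norm_def by blast
  show ?thesis
  proof (intro exI allI)
    fix x
    have "indicator S x * g x \<in> insert 0 (g ` E \<union> {-M..M})"
      using assms(2)[of x] by (force simp: indicator_def abs_le_iff)
    then show "\<bar>indicator S x * g x\<bar> \<le> N" by (rule N)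
  qed
qed

lemma piecewise_continuous_bounded:
  assumes "piecewise_continuous_on_unit_interval g"
  shows "bounded (g ` {0..1})"
proof -
  have loc: "\<exists>U. open U \<and> t \<in> U \<and> bounded (g ` (U \<inter> {0..1}))" if t: "t \<in> {0..1}" for t
  proof -
    have R: "\<exists>B. eventually (\<lambda>x. x \<le> 1 \<longrightarrow> \<bar>g x\<bar> \<le> B) (at_right t)"
    proof (cases "t < 1")
      case True
      then obtain l where "(g \<longlongrightarrow> l) (at_right t)"
        using assms t unfolding piecewise_continuous_on_unit_interval_def by force
      from tendstoD[OF this, of 1] have "eventually (\<lambda>x. \<bar>g x\<bar> \<le> \<bar>l\<bar> + 1) (at_right t)"
        by (auto simp: dist_real_def elim!: eventually_mono)
      then show ?thesis by (auto elim: eventually_mono)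
    next
      case False
      then show ?thesis using t by (auto simp: eventually_at_filter)
    qed
    have L: "\<exists>B. eventually (\<lambda>x. x \<ge> 0 \<longrightarrow> \<bar>g x\<bar> \<le> B) (at_left t)"
    proof (cases "t > 0")
      case True
      then obtain l where "(g \<longlongrightarrow> l) (at_left t)"
        using assms t unfolding piecewise_continuous_on_unit_interval_def by force
      from tendstoD[OF this, of 1] have "eventually (\<lambda>x. \<bar>g x\<bar> \<le> \<bar>l\<bar> + 1) (at_left t)"
        by (auto simp: dist_real_def elim!: eventually_mono)
      then show ?thesis by (auto elim: eventually_mono)
    next
      case False
      then show ?thesis using t by (auto simp: eventually_at_filter)
    qed
    obtain A B where "eventually (\<lambda>x. x \<le> 1 \<longrightarrow> \<bar>g x\<bar> \<le> A) (at_right t)"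
      "eventually (\<lambda>x. x \<ge> 0 \<longrightarrow> \<bar>g x\<bar> \<le> B) (at_left t)" using R L by blast
    then have "eventually (\<lambda>x. x \<in> {0..1} \<longrightarrow> \<bar>g x\<bar> \<le> max \<bar>g t\<bar> (max A B)) (nhds t)"
      unfolding eventually_at_filter
    proof eventually_elim
      case (elim x)
      then show ?case by (cases x t rule: linorder_cases) auto
    qed
    then obtain U where "open U" "t \<in> U" "\<And>x. x \<in> U \<Longrightarrow> x \<in> {0..1} \<Longrightarrow> \<bar>g x\<bar> \<le> max \<bar>g t\<bar> (max A B)"
      unfolding eventually_nhds by blast
    then show ?thesis
      by (intro exI[of _ U]) (auto simp: bounded_iff intro!: exI[of _ "max \<bar>g t\<bar> (max A B)"])
  qed
  then obtain U where U: "\<And>t. t \<in> {0..1} \<Longrightarrow> open (U t)" "\<And>t. t \<in> {0..1} \<Longrightarrow> t \<in> U t"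
    "\<And>t. t \<in> {0..1} \<Longrightarrow> bounded (g ` (U t \<inter> {0..1}))"
    by metis
  obtain F where F: "F \<subseteq> {0..1}" "finite F" "{0..1} \<subseteq> (\<Union>t\<in>F. U t)"
    using compactE_image[OF compact_Icc[of 0 "1::real"], of "{0..1}" U] U by blast
  have "bounded (\<Union>t\<in>F. g ` (U t \<inter> {0..1}))"
    using F U(3) by (intro bounded_UN) auto
  then show ?thesis
    by (rule bounded_subset) (use F(3) in blast)
qed

text \<open>Continuity of \<open>f \<circ> \<gamma>\<close> descends to \<open>f\<close> on the curve because a point other than the end points
  of a simple path has just one preimage; the end points are simply made exceptional.\<close>

lemma simple_path_continuous_off_finite:
  fixes \<gamma> :: "real \<Rightarrow> 'a :: metric_space"
  assumes \<gamma>: "simple_path \<gamma>" "path_image \<gamma> = C"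
    and pc: "piecewise_continuous_on_unit_interval (f \<circ> \<gamma>)"
  obtains E where "finite E" "\<And>\<zeta>. \<zeta> \<in> C - E \<Longrightarrow> (f \<longlongrightarrow> f \<zeta>) (at \<zeta> within C)"
proof -
  obtain T where T: "finite T" "\<And>t. t \<in> {0..1} - T \<Longrightarrow> continuous (at t within {0..1}) (f \<circ> \<gamma>)"
    using pc unfolding piecewise_continuous_on_unit_interval_def by blast
  show ?thesis
  proof (rule that)
    show "finite (\<gamma> ` (T \<union> {0, 1}))" using T by simp
    fix \<zeta> assume \<zeta>: "\<zeta> \<in> C - \<gamma> ` (T \<union> {0, 1})"
    then obtain t where t: "t \<in> {0..1}" "\<gamma> t = \<zeta>"
      using \<gamma>(2) by (auto simp: path_image_def)
    with \<zeta> have t': "t \<notin> T" "t \<noteq> 0" "t \<noteq> 1" by auto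
    show "(f \<longlongrightarrow> f \<zeta>) (at \<zeta> within C)"
    proof (rule tendsto_pushforward)
      show "compact {0..1::real}" by simp
      show "continuous_on {0..1} \<gamma>" using \<gamma>(1) by (simp add: simple_path_def path_def)
      show "{0..1::real} \<subseteq> {0..1}" by simp
      fix x assume x: "x \<in> {0..1}" "\<gamma> x = \<zeta>"
      then have "x = t"
        using \<gamma>(1) t t' by (fastforce simp: simple_path_def loop_free_def)
      then show "((f \<circ> \<gamma>) \<longlongrightarrow> f \<zeta>) (at x within {0..1})"
        using T(2)[of t] t t' by (simp add: continuous_within)
    next
      fix z assume "z \<in> C"
      then show "\<exists>t\<in>{0..1}. \<gamma> t = z \<and> f z = (f \<circ> \<gamma>) t"
        using \<gamma>(2) by (auto simp: path_image_def)
    qed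
  qed
qed

lemma piecewise_continuous_on_boundaryD:
  assumes D: "bounded_jordan_domain n D" and f: "piecewise_continuous_on_boundary D f"
  obtains E M where "finite E" "\<And>\<zeta>. \<zeta> \<in> frontier D - E \<Longrightarrow> (f \<longlongrightarrow> f \<zeta>) (at \<zeta> within frontier D)"
    "\<And>\<zeta>. \<zeta> \<in> frontier D \<Longrightarrow> \<bar>f \<zeta>\<bar> \<le> M"
proof -
  obtain CC where CC: "finite CC" "\<And>C. C \<in> CC \<Longrightarrow> jordan_curve C" "pairwise disjnt CC" "frontier D = \<Union>CC"
    using D unfolding bounded_jordan_domain_def by blast
  have "\<exists>\<gamma>. simple_path \<gamma> \<and> pathfinish \<gamma> = pathstart \<gamma> \<and> path_image \<gamma> = C" if "C \<in> CC" for C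
    using CC(2)[OF that] unfolding jordan_curve_def by blast
  then obtain \<gamma> where \<gamma>: "\<And>C. C \<in> CC \<Longrightarrow> simple_path (\<gamma> C)"
    "\<And>C. C \<in> CC \<Longrightarrow> pathfinish (\<gamma> C) = pathstart (\<gamma> C)" "\<And>C. C \<in> CC \<Longrightarrow> path_image (\<gamma> C) = C"
    by metis
  have pc: "piecewise_continuous_on_unit_interval (f \<circ> \<gamma> C)" if "C \<in> CC" for C
    using f \<gamma>[OF that] CC(4) that unfolding piecewise_continuous_on_boundary_def by blast
  have "\<exists>E. finite E \<and> (\<forall>\<zeta>\<in>C - E. (f \<longlongrightarrow> f \<zeta>) (at \<zeta> within C))" if "C \<in> CC" for C
    using simple_path_continuous_off_finite[OF \<gamma>(1)[OF that] \<gamma>(3)[OF that] pc[OF that]] by metis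
  then obtain E where E: "\<And>C. C \<in> CC \<Longrightarrow> finite (E C)"
    "\<And>C \<zeta>. C \<in> CC \<Longrightarrow> \<zeta> \<in> C - E C \<Longrightarrow> (f \<longlongrightarrow> f \<zeta>) (at \<zeta> within C)"
    by metis
  have closed: "closed C" if "C \<in> CC" for C
    using \<gamma>(1,3)[OF that] closed_path_image simple_path_imp_path by metis
  have "f ` C = (f \<circ> \<gamma> C) ` {0..1}" if "C \<in> CC" for C
    using \<gamma>(3)[OF that] by (metis image_comp path_image_def)
  then have "bounded (f ` C)" if "C \<in> CC" for C
    using piecewise_continuous_bounded[OF pc[OF that]] that by simp
  then have "bounded (\<Union>C\<in>CC. f ` C)" using CC(1) by (intro bounded_UN) auto
  then have "bounded (f ` frontier D)" by (rule bounded_subset) (use CC(4) in auto)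
  then obtain M where M: "\<And>\<zeta>. \<zeta> \<in> frontier D \<Longrightarrow> \<bar>f \<zeta>\<bar> \<le> M"
    unfolding bounded_iff by auto
  show ?thesis
  proof (rule that[OF _ _ M])
    show "finite (\<Union>C\<in>CC. E C)" using CC(1) E(1) by blast
    fix \<zeta> assume \<zeta>: "\<zeta> \<in> frontier D - (\<Union>C\<in>CC. E C)"
    then obtain C where C: "C \<in> CC" "\<zeta> \<in> C - E C" using CC(4) by blast
    have "at \<zeta> within frontier D = at \<zeta> within C"
    proof (rule at_within_nhd)
      show "\<zeta> \<in> - \<Union>(CC - {C})"
        using CC(3) C by (fastforce simp: pairwise_def disjnt_def)
      show "open (- \<Union>(CC - {C}))" using CC(1) closed by (auto intro!: open_Compl closed_Union)
      show "frontier D \<inter> - \<Union>(CC - {C}) - {\<zeta>} = C \<inter> - \<Union>(CC - {C}) - {\<zeta>}"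
        using CC(4) C(1) by blast
    qed
    then show "(f \<longlongrightarrow> f \<zeta>) (at \<zeta> within frontier D)" using E(2)[OF C] by simp
  qed
qed

section \<open>The operator as an iterated Poisson integral\<close>

lemma poisson_integral_indicator:
  "poisson_integral \<phi> S g = poisson_integral \<phi> UNIV (\<lambda>x. indicator S x * g x)"
  by (simp add: fun_eq_iff poisson_integral_eq_disc_poisson)

text \<open>At points of \<open>\<sigma>\<close> on the outer boundary \<open>disc_inv \<phi>2\<close> makes an arbitrary choice; assuming
  only that it is Borel on \<open>\<sigma>\<close>, with values in the closed disc, covers these points as well.\<close>

lemma iterated_poisson_integral_eq_kernel_integral:
  fixes v :: "complex \<Rightarrow> real"
  assumes \<phi>1: "extended_riemann_map \<phi>1 G1" and z: "z \<in> closure G1"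
    and \<phi>2: "extended_riemann_map \<phi>2 G2" and \<sigma>: "\<sigma> \<in> sets borel" "\<sigma> \<subseteq> closure G2"
    and meas: "(\<lambda>x. indicator \<sigma> x *\<^sub>R disc_inv \<phi>2 x) \<in> borel_measurable borel"
    and v: "(\<lambda>x. indicator \<tau> x * v x) \<in> borel_measurable borel" "\<And>x. \<bar>indicator \<tau> x * v x\<bar> \<le> B"
  shows "1 / (2*pi)\<^sup>2 * circle_integral (disc_preimage \<phi>2 \<tau>)
      (\<lambda>\<zeta>1. K_kernel \<sigma> \<phi>1 \<phi>2 z \<zeta>1 * v (\<phi>2 \<zeta>1))
    = poisson_integral \<phi>1 \<sigma> (poisson_integral \<phi>2 \<tau> v) z"
proof -
  have z1: "cmod (disc_inv \<phi>1 z) \<le> 1" using disc_inv_closure(1)[OF \<phi>1 z] by simp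
  obtain A where A: "A \<ge> 0" "\<And>\<zeta>. cmod \<zeta> = 1 \<Longrightarrow> \<bar>poisson_kernel (disc_inv \<phi>1 z) \<zeta>\<bar> \<le> A"
    using poisson_kernel_bound[OF z1] by blast
  define a where "a t = indicator \<sigma> (\<phi>1 (cis t)) * poisson_kernel (disc_inv \<phi>1 z) (cis t)" for t
  define w where "w t = indicator \<sigma> (\<phi>1 (cis t)) *\<^sub>R disc_inv \<phi>2 (\<phi>1 (cis t))" for t
  define b where "b t = indicator \<tau> (\<phi>2 (cis t)) * v (\<phi>2 (cis t))" for t
  have ind: "(\<lambda>t. indicator \<sigma> (\<phi>1 (cis t)) :: real) \<in> borel_measurable borel"
    by (rule measurable_compose[OF extended_riemann_map_measurable[OF \<phi>1] borel_measurable_indicator[OF \<sigma>(1)]])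
  have a_meas: "a \<in> borel_measurable borel"
    unfolding a_def using ind by measurable
  have a_bd: "\<bar>a t\<bar> \<le> A" for t
    using A(1) A(2)[of "cis t"] by (auto simp: a_def indicator_def)
  have b_meas: "b \<in> borel_measurable borel"
    unfolding b_def using measurable_compose_riemann_map[OF \<phi>2 v(1)] .
  have b_bd: "\<bar>b t\<bar> \<le> B" for t unfolding b_def by (rule v(2))
  have w_meas: "w \<in> borel_measurable borel"
    unfolding w_def using measurable_compose[OF extended_riemann_map_measurable[OF \<phi>1] meas] .
  have w_bd: "cmod (w t) \<le> 1" for t
    using disc_inv_closure(1)[OF \<phi>2, of "\<phi>1 (cis t)"] \<sigma>(2) by (auto simp: w_def indicator_def)
  have K: "K_kernel \<sigma> \<phi>1 \<phi>2 z (cis s) = (\<integral>t. a t * poisson_kernel (w t) (cis s) \<partial>angle_measure)" for s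
    unfolding K_kernel_def circle_integral_eq indicator_disc_preimage
    by (rule Bochner_Integration.integral_cong) (auto simp: a_def w_def indicator_def)
  have "circle_integral (disc_preimage \<phi>2 \<tau>) (\<lambda>\<zeta>1. K_kernel \<sigma> \<phi>1 \<phi>2 z \<zeta>1 * v (\<phi>2 \<zeta>1))
      = (\<integral>s. (\<integral>t. a t * poisson_kernel (w t) (cis s) \<partial>angle_measure) * b s \<partial>angle_measure)"
    unfolding circle_integral_eq indicator_disc_preimage K
    by (rule Bochner_Integration.integral_cong) (auto simp: b_def mult_ac)
  also have "\<dots> = (\<integral>t. a t * (\<integral>s. poisson_kernel (w t) (cis s) * b s \<partial>angle_measure) \<partial>angle_measure)"
    by (rule Fubini_poisson[OF a_meas a_bd b_meas b_bd w_meas w_bd])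
  also have "\<dots> = (\<integral>t. (2 * pi) * (poisson_kernel (disc_inv \<phi>1 z) (cis t) *
      (indicator \<sigma> (\<phi>1 (cis t)) * poisson_integral \<phi>2 \<tau> v (\<phi>1 (cis t)))) \<partial>angle_measure)"
    by (rule Bochner_Integration.integral_cong)
      (auto simp: a_def w_def b_def poisson_integral_eq_disc_poisson disc_poisson_def indicator_def)
  also have "\<dots> = (2 * pi)\<^sup>2 * poisson_integral \<phi>1 \<sigma> (poisson_integral \<phi>2 \<tau> v) z"
    by (simp add: poisson_integral_eq_disc_poisson[of \<phi>1] disc_poisson_def power2_eq_square)
  finally show ?thesis by simp
qed

section \<open>Boundary limits in a slit domain\<close>

lemma frontier_slit_domain:
  assumes "closed S" shows "frontier (D - S) \<subseteq> frontier D \<union> S"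
proof -
  have "frontier (D \<inter> - S) \<subseteq> frontier D \<union> frontier (- S)" by (rule frontier_Int_subset)
  then show ?thesis using frontier_subset_closed[OF assms] by (auto simp: frontier_complement Diff_eq)
qed

lemma at_within_le_nhd:
  fixes q :: "'a :: topological_space"
  assumes "open U" "q \<in> U" "A \<inter> U \<subseteq> B"
  shows "at q within A \<le> at q within B"
proof -
  have "at q within A = at q within (A \<inter> U)"
    by (rule at_within_nhd[OF assms(2,1)]) auto
  also have "\<dots> \<le> at q within B" by (rule at_le[OF assms(3)])
  finally show ?thesis .
qed

text \<open>Near a point of \<open>D\<close> only the slits, and near a point off the slits only the outer boundary
  contributes boundary points of \<open>D - S\<close>, so the boundary function agrees locally with \<open>v\<close>
  or with \<open>f\<close>.\<close>

lemma slit_poisson_tendsto_boundary: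
  assumes \<phi>: "extended_riemann_map \<phi> (D - S)" and D: "open D" and S: "closed S"
    and k: "k \<in> borel_measurable borel" "\<And>x. \<bar>k x\<bar> \<le> M"
    and k_eq: "k = (\<lambda>x. indicator (frontier D) x * f x + indicator S x * v x)"
    and q: "q \<in> frontier D" "q \<notin> S" and f: "(f \<longlongrightarrow> f q) (at q within frontier D)"
  shows "(poisson_integral \<phi> UNIV k \<longlongrightarrow> f q) (at q within D)"
proof -
  have kq: "k q = f q" using q by (simp add: k_eq)
  have "(k \<longlongrightarrow> f q) (at q within (frontier D - S))"
  proof (rule Lim_transform_eventually)
    show "(f \<longlongrightarrow> f q) (at q within (frontier D - S))"
      by (rule tendsto_within_subset[OF f]) auto
    show "eventually (\<lambda>x. f x = k x) (at q within (frontier D - S))"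
      by (auto simp: eventually_at_filter k_eq)
  qed
  moreover have "at q within frontier (D - S) \<le> at q within (frontier D - S)"
    by (rule at_within_le_nhd[of "- S"]) (use S q frontier_slit_domain[OF S] in auto)
  ultimately have "(k \<longlongrightarrow> k q) (at q within frontier (D - S))"
    unfolding kq by (rule tendsto_mono[rotated])
  then have "(poisson_integral \<phi> UNIV k \<longlongrightarrow> f q) (at q within (D - S))"
    unfolding kq[symmetric]
    by (rule poisson_integral_tendsto[OF \<phi> open_Diff[OF D S] k, rotated])
      (use q D in \<open>auto simp: frontier_def interior_open\<close>)
  moreover have "at q within D \<le> at q within (D - S)"
    by (rule at_within_le_nhd[of "- S"]) (use S q in auto)
  ultimately show ?thesis by (rule tendsto_mono[rotated])
qed

lemma slit_poisson_tendsto_slit: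
  assumes \<phi>: "extended_riemann_map \<phi> (D - S)" and D: "open D" and S: "closed S"
    and k: "k \<in> borel_measurable borel" "\<And>x. \<bar>k x\<bar> \<le> M"
    and k_eq: "k = (\<lambda>x. indicator (frontier D) x * f x + indicator S x * v x)"
    and q: "q \<in> D" "q \<in> S" and v: "isCont v q"
  shows "(poisson_integral \<phi> UNIV k \<longlongrightarrow> v q) (at q within (D - S))"
proof -
  have fr: "x \<notin> frontier D" if "x \<in> D" for x
    using that D by (simp add: frontier_def interior_open)
  have kq: "k q = v q" using q fr by (simp add: k_eq)
  have "(k \<longlongrightarrow> v q) (at q within (D \<inter> S))"
  proof (rule Lim_transform_eventually)
    show "(v \<longlongrightarrow> v q) (at q within (D \<inter> S))"
      using v by (auto simp: isCont_def intro: tendsto_within_subset)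
    show "eventually (\<lambda>x. v x = k x) (at q within (D \<inter> S))"
      by (auto simp: eventually_at_filter k_eq fr)
  qed
  moreover have "at q within frontier (D - S) \<le> at q within (D \<inter> S)"
    by (rule at_within_le_nhd[of D]) (use D q fr frontier_slit_domain[OF S, of D] in auto)
  ultimately have "(k \<longlongrightarrow> k q) (at q within frontier (D - S))"
    unfolding kq by (rule tendsto_mono[rotated])
  then show ?thesis
    unfolding kq[symmetric]
    by (rule poisson_integral_tendsto[OF \<phi> open_Diff[OF D S] k, rotated]) (use q in auto)
qed

lemma slits_topology:
  assumes "\<And>j. j \<in> J \<Longrightarrow> crosscut D (s j)" and "finite J" and S: "S = (\<Union>j\<in>J. path_image (s j))"
  shows "closed S" "finite (S - D)" "S \<subseteq> closure D"
proof -
  have cl: "closed (path_image (s j))" if "j \<in> J" for j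
    using assms(1)[OF that] by (simp add: crosscut_def closed_arc_image)
  then show "closed S" unfolding S using assms(2) by auto
  have ends: "path_image (s j) \<subseteq> D \<union> {pathstart (s j), pathfinish (s j)}" if "j \<in> J" for j
    using assms(1)[OF that] by (auto simp: crosscut_def)
  then have "S - D \<subseteq> (\<Union>j\<in>J. {pathstart (s j), pathfinish (s j)})" unfolding S by blast
  then show "finite (S - D)" by (rule finite_subset) (use assms(2) in auto)
  have "path_image (s j) \<subseteq> closure D" if "j \<in> J" for j
    using ends[OF that] assms(1)[OF that] closure_subset[of D]
    by (auto simp: crosscut_def frontier_def)
  then show "S \<subseteq> closure D" unfolding S by blast
qed

section \<open>The fixed point solves the Dirichlet problem\<close>

text \<open>The topological content of the hypotheses: \<open>\<sigma>\<close> and \<open>\<tau>\<close> are disjoint unions of slits, meeting the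
  outer boundary in finitely many end points, and \<open>E\<close> contains the discontinuities of \<open>f\<close> on that
  boundary.\<close>

locale slit_pair =
  fixes D \<sigma> \<tau> E :: "complex set" and \<phi>1 \<phi>2 :: "complex \<Rightarrow> complex" and f :: "complex \<Rightarrow> real" and Mf :: real
  assumes D: "open D" "bounded D"
    and \<sigma>: "closed \<sigma>" "finite (\<sigma> - D)" "\<sigma> \<subseteq> closure D"
    and \<tau>: "closed \<tau>" "finite (\<tau> - D)"
    and disj: "\<sigma> \<inter> \<tau> = {}"
    and \<phi>1: "extended_riemann_map \<phi>1 (D - \<sigma>)"
    and \<phi>2: "extended_riemann_map \<phi>2 (D - \<tau>)"
    and E: "finite E"
    and f_cont: "\<And>\<zeta>. \<zeta> \<in> frontier D - E \<Longrightarrow> (f \<longlongrightarrow> f \<zeta>) (at \<zeta> within frontier D)"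
    and f_bdd: "\<And>\<zeta>. \<zeta> \<in> frontier D \<Longrightarrow> \<bar>f \<zeta>\<bar> \<le> Mf"
begin

lemma open_slit_domains: "open (D - \<sigma>)" "open (D - \<tau>)"
  using D \<sigma> \<tau> by auto

lemma slit_interior_subset: "\<sigma> - (\<sigma> - D) \<subseteq> D - \<tau>" "\<tau> - (\<tau> - D) \<subseteq> D - \<sigma>"
  using disj by auto

lemma \<sigma>_subset_closure: "\<sigma> \<subseteq> closure (D - \<tau>)"
  using open_Int_closure_subset[of "- \<tau>" D] \<tau>(1) \<sigma>(3) disj by (auto simp: Diff_eq Int_commute)

definition outer_data :: "complex \<Rightarrow> real" where
  "outer_data x = indicator (frontier D) x * f x"

definition data_on :: "complex set \<Rightarrow> (complex \<Rightarrow> real) \<Rightarrow> complex \<Rightarrow> real" where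
  "data_on S v x = indicator S x * v x"

lemma outer_data_measurable: "outer_data \<in> borel_measurable borel"
proof -
  have "continuous_on (frontier D - E) f"
    unfolding continuous_on_def by (blast intro: tendsto_within_subset f_cont)
  then show ?thesis
    using measurable_indicator_mult_continuous_off_finite[of "frontier D" E f] E
    by (simp add: outer_data_def[abs_def] borel_closed)
qed

lemma outer_data_bounded: "\<exists>N. \<forall>x. \<bar>outer_data x\<bar> \<le> N"
  using bounded_indicator_off_finite[of "{}" "frontier D" f Mf] f_bdd unfolding outer_data_def by auto

text \<open>At the finitely many end points of the slits the values of \<open>v\<close> are arbitrary, but
  finitely many values affect neither measurability nor boundedness.\<close>

lemma data_on_slit:
  assumes "closed S" "finite (S - D)" "S - (S - D) \<subseteq> G" "harmonic_on v G" "\<And>x. x \<in> G \<Longrightarrow> \<bar>v x\<bar> \<le> M"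
  shows "data_on S v \<in> borel_measurable borel" "\<exists>N. \<forall>x. \<bar>data_on S v x\<bar> \<le> N"
proof -
  have "continuous_on (S - (S - D)) v"
    by (rule continuous_on_subset[OF harmonic_on_imp_continuous_on[OF assms(4)] assms(3)])
  then show "data_on S v \<in> borel_measurable borel"
    unfolding data_on_def[abs_def]
    by (rule measurable_indicator_mult_continuous_off_finite[OF borel_closed[OF assms(1)] assms(2)])
  have "\<bar>v x\<bar> \<le> M" if "x \<in> S - (S - D)" for x using assms(3,5) that by blast
  then show "\<exists>N. \<forall>x. \<bar>data_on S v x\<bar> \<le> N"
    using bounded_indicator_off_finite[OF assms(2)] unfolding data_on_def by blast
qed

lemma boundary_data:
  assumes "closed S" "finite (S - D)" "S - (S - D) \<subseteq> G" "harmonic_on v G" "\<And>x. x \<in> G \<Longrightarrow> \<bar>v x\<bar> \<le> M"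
  shows "(\<lambda>x. outer_data x + data_on S v x) \<in> borel_measurable borel"
    and "\<exists>N. \<forall>x. \<bar>outer_data x + data_on S v x\<bar> \<le> N"
proof -
  note v = data_on_slit[OF assms]
  show "(\<lambda>x. outer_data x + data_on S v x) \<in> borel_measurable borel"
    by (rule borel_measurable_add[OF outer_data_measurable v(1)])
  obtain A where A: "\<And>x. \<bar>outer_data x\<bar> \<le> A" using outer_data_bounded by blast
  obtain B where B: "\<And>x. \<bar>data_on S v x\<bar> \<le> B" using v(2) by blast
  have "\<bar>outer_data x + data_on S v x\<bar> \<le> A + B" for x
    using A[of x] B[of x] by linarith
  then show "\<exists>N. \<forall>x. \<bar>outer_data x + data_on S v x\<bar> \<le> N" by blast
qed

text \<open>The kernel term of the operator is the Poisson integral over \<open>\<sigma>\<close> of a Poisson integral over \<open>\<tau>\<close>.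
  The latter and the function \<open>H\<^sub>2\<close>, which enters through \<open>H\<^sub>3\<close>, add up to \<open>W\<close>.\<close>

lemma fixed_point_representation:
  assumes harm_u: "harmonic_on u (D - \<sigma>)" and Mu: "\<And>z. z \<in> D - \<sigma> \<Longrightarrow> \<bar>u z\<bar> \<le> Mu"
    and fixed: "\<And>z. z \<in> D - \<sigma> \<Longrightarrow> F_op D f \<sigma> \<tau> \<phi>1 \<phi>2 u z = u z"
  defines "W \<equiv> poisson_integral \<phi>2 UNIV (\<lambda>x. outer_data x + data_on \<tau> u x)"
  assumes z: "z \<in> D - \<sigma>"
  shows "u z = poisson_integral \<phi>1 UNIV (\<lambda>x. outer_data x + data_on \<sigma> W x) z"
proof -
  note op = open_slit_domains
  have zc: "z \<in> closure (D - \<sigma>)" using subsetD[OF closure_subset z] .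
  obtain Nf where f_le: "\<And>x. \<bar>outer_data x\<bar> \<le> Nf" using outer_data_bounded by blast
  note f = outer_data_measurable f_le
  note u' = data_on_slit[OF \<tau>(1,2) slit_interior_subset(2) harm_u Mu]
  obtain Nu where u_le: "\<And>x. \<bar>data_on \<tau> u x\<bar> \<le> Nu" using u'(2) by blast
  note u = u'(1) u_le
  define P Q where "P = poisson_integral \<phi>2 UNIV outer_data"
    and "Q = poisson_integral \<phi>2 UNIV (data_on \<tau> u)"
  have H1: "H1 D f \<phi>1 = poisson_integral \<phi>1 UNIV outer_data"
    and H2: "H2 D f \<phi>2 = P"
    unfolding H1_def H2_def P_def poisson_integral_indicator[of _ "frontier D"] outer_data_def by simp_all
  have Q: "poisson_integral \<phi>2 \<tau> u = Q"
    unfolding Q_def poisson_integral_indicator[of _ \<tau>] data_on_def[abs_def] ..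
  have closure: "x \<in> closure (D - \<tau>)" if "x \<in> D - \<tau>" for x
    by (rule subsetD[OF closure_subset that])
  note P' = data_on_slit[OF \<sigma>(1,2) slit_interior_subset(1)
      harmonic_on_poisson_integral[OF \<phi>2 op(2) f, folded P_def]
      abs_poisson_integral_le[OF \<phi>2 closure f, folded P_def]]
  obtain NP where P_le: "\<And>x. \<bar>data_on \<sigma> P x\<bar> \<le> NP" using P'(2) by blast
  note P = P'(1) P_le
  note Q' = data_on_slit[OF \<sigma>(1,2) slit_interior_subset(1)
      harmonic_on_poisson_integral[OF \<phi>2 op(2) u, folded Q_def]
      abs_poisson_integral_le[OF \<phi>2 closure u, folded Q_def]]
  obtain NQ where Q_le: "\<And>x. \<bar>data_on \<sigma> Q x\<bar> \<le> NQ" using Q'(2) by blast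
  note Q' = Q'(1) Q_le
  have PQ: "(\<lambda>x. data_on \<sigma> P x + data_on \<sigma> Q x) \<in> borel_measurable borel"
    "\<And>x. \<bar>data_on \<sigma> P x + data_on \<sigma> Q x\<bar> \<le> NP + NQ"
    using borel_measurable_add[OF P(1) Q'(1)]
      abs_triangle_ineq[THEN order_trans, OF add_mono[OF P(2) Q'(2)]] by blast+
  have W: "data_on \<sigma> W = (\<lambda>x. data_on \<sigma> P x + data_on \<sigma> Q x)"
  proof
    fix x show "data_on \<sigma> W x = data_on \<sigma> P x + data_on \<sigma> Q x"
      using poisson_integral_UNIV_add[OF \<phi>2 _ f u, folded P_def Q_def W_def, of x]
        \<sigma>_subset_closure
      by (auto simp: data_on_def indicator_def)
  qed
  have "continuous_on (\<sigma> - (\<sigma> - D)) (disc_inv \<phi>2)"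
    by (rule continuous_on_subset[OF holomorphic_on_imp_continuous_on[OF
          disc_inv_holomorphic[OF \<phi>2 op(2)]] slit_interior_subset(1)])
  then have meas: "(\<lambda>x. indicator \<sigma> x *\<^sub>R disc_inv \<phi>2 x) \<in> borel_measurable borel"
    by (rule measurable_indicator_continuous_off_finite[OF borel_closed[OF \<sigma>(1)] \<sigma>(2)])
  have "u z = H1 D f \<phi>1 z + H3 D f \<sigma> \<phi>1 \<phi>2 z + poisson_integral \<phi>1 \<sigma> (poisson_integral \<phi>2 \<tau> u) z"
    using fixed[OF z] iterated_poisson_integral_eq_kernel_integral[OF \<phi>1 zc \<phi>2
        borel_closed[OF \<sigma>(1)] \<sigma>_subset_closure meas u[unfolded data_on_def]]
    by (simp add: F_op_def h_fun_def)
  also have "\<dots> = poisson_integral \<phi>1 UNIV outer_data z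
      + (poisson_integral \<phi>1 UNIV (data_on \<sigma> P) z + poisson_integral \<phi>1 UNIV (data_on \<sigma> Q) z)"
    unfolding H1 H3_def H2 Q poisson_integral_indicator[of _ \<sigma>] data_on_def by simp
  also have "\<dots> = poisson_integral \<phi>1 UNIV (\<lambda>x. outer_data x + data_on \<sigma> W x) z"
    using poisson_integral_UNIV_add[OF \<phi>1 zc P Q'] poisson_integral_UNIV_add[OF \<phi>1 zc f PQ]
    unfolding W by linarith
  finally show ?thesis .
qed

text \<open>The functions \<open>u\<close> and \<open>W\<close> have the same boundary limits on \<open>D - (\<sigma> \<union> \<tau>)\<close>, except at the
  discontinuities of \<open>f\<close> and the end points of the slits, so they agree there by the maximum
  principle, and each continues the other across the slits of its own domain.  As \<open>\<sigma>\<close> and \<open>\<tau>\<close> are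
  disjoint, every point of the outer boundary is off one of them, and the function belonging to
  that system of slits tends to \<open>f\<close> there.\<close>

lemma coupled_solutions_glue:
  assumes harm_u: "harmonic_on u (D - \<sigma>)" and Mu: "\<And>z. z \<in> D - \<sigma> \<Longrightarrow> \<bar>u z\<bar> \<le> Mu"
  defines "W \<equiv> poisson_integral \<phi>2 UNIV (\<lambda>x. outer_data x + data_on \<tau> u x)"
  assumes u_eq: "\<And>z. z \<in> D - \<sigma> \<Longrightarrow>
    u z = poisson_integral \<phi>1 UNIV (\<lambda>x. outer_data x + data_on \<sigma> W x) z"
  shows "\<exists>U. harmonic_on U D \<and> (\<forall>z\<in>D - \<sigma>. U z = u z) \<and>
           (\<forall>\<zeta>\<in>frontier D. (f \<longlongrightarrow> f \<zeta>) (at \<zeta> within frontier D) \<longrightarrow>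
              (U \<longlongrightarrow> f \<zeta>) (at \<zeta> within D))"
proof -
  define D1 D2 where "D1 = D - \<sigma>" and "D2 = D - \<tau>"
  note op = open_slit_domains[folded D1_def D2_def]
  note harm_u = harm_u[folded D1_def] and Mu = Mu[folded D1_def] and u_eq = u_eq[folded D1_def]
  define k1 k2 where "k1 x = outer_data x + data_on \<sigma> W x"
    and "k2 x = outer_data x + data_on \<tau> u x" for x
  note k2' = boundary_data[OF \<tau>(1,2) slit_interior_subset(2)[folded D1_def] harm_u Mu,
      folded k2_def]
  obtain N2 where k2_le: "\<And>x. \<bar>k2 x\<bar> \<le> N2" using k2'(2) by blast
  note k2 = k2'(1) k2_le
  have W: "W = poisson_integral \<phi>2 UNIV k2" by (simp add: W_def k2_def[abs_def])
  have harm_W: "harmonic_on W D2"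
    unfolding W D2_def by (rule harmonic_on_poisson_integral[OF \<phi>2 open_slit_domains(2) k2])
  have W_bd: "\<bar>W z\<bar> \<le> N2" if "z \<in> D2" for z
    unfolding W
    by (rule abs_poisson_integral_le[OF \<phi>2 subsetD[OF closure_subset] k2])
      (use that in \<open>simp add: D2_def\<close>)
  note k1' = boundary_data[OF \<sigma>(1,2) slit_interior_subset(1)[folded D2_def] harm_W W_bd,
      folded k1_def]
  obtain N1 where k1_le: "\<And>x. \<bar>k1 x\<bar> \<le> N1" using k1'(2) by blast
  note k1 = k1'(1) k1_le
  have k_eq: "k1 = (\<lambda>x. indicator (frontier D) x * f x + indicator \<sigma> x * W x)"
    "k2 = (\<lambda>x. indicator (frontier D) x * f x + indicator \<tau> x * u x)"
    by (simp_all add: fun_eq_iff k1_def k2_def outer_data_def data_on_def)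
  note u_bdry = slit_poisson_tendsto_boundary[OF \<phi>1 D(1) \<sigma>(1) k1 k_eq(1)]
  note W_bdry = slit_poisson_tendsto_boundary[OF \<phi>2 D(1) \<tau>(1) k2 k_eq(2), folded W]
  note u_slit = slit_poisson_tendsto_slit[OF \<phi>1 D(1) \<sigma>(1) k1 k_eq(1), folded D1_def]
  note W_slit = slit_poisson_tendsto_slit[OF \<phi>2 D(1) \<tau>(1) k2 k_eq(2), folded W D2_def]
  have u_lim: "(u \<longlongrightarrow> l) (at q within A)"
    if "(poisson_integral \<phi>1 UNIV k1 \<longlongrightarrow> l) (at q within B)" "A \<subseteq> B" "A \<subseteq> D1" for l q A B
  proof (rule Lim_transform_eventually)
    show "(poisson_integral \<phi>1 UNIV k1 \<longlongrightarrow> l) (at q within A)"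
      by (rule tendsto_within_subset[OF that(1,2)])
    show "eventually (\<lambda>x. poisson_integral \<phi>1 UNIV k1 x = u x) (at q within A)"
      unfolding eventually_at_filter
      by (rule always_eventually) (use that(3) u_eq in \<open>auto simp: k1_def[abs_def]\<close>)
  qed
  have u_isCont: "isCont u q" if "q \<in> D1" for q
    using harmonic_on_imp_continuous_on[OF harm_u] op(1) that
    by (simp add: continuous_on_eq_continuous_at)
  have W_isCont: "isCont W q" if "q \<in> D2" for q
    using harmonic_on_imp_continuous_on[OF harm_W] op(2) that
    by (simp add: continuous_on_eq_continuous_at)
  define \<Omega> where "\<Omega> = D1 \<inter> D2"
  have \<Omega>: "open \<Omega>" "bounded \<Omega>" "\<Omega> \<subseteq> D1" "\<Omega> \<subseteq> D2" "\<Omega> \<subseteq> D"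
    using op D(2) by (auto simp: \<Omega>_def D1_def intro: bounded_subset)
  define X where "X = E \<union> (\<sigma> - D) \<union> (\<tau> - D)"
  have X: "finite X" using E \<sigma>(2) \<tau>(2) by (simp add: X_def)
  have diff_lim: "((\<lambda>z. u z - W z) \<longlongrightarrow> 0) (at q within \<Omega>)"
    if q: "q \<in> frontier \<Omega>" "q \<notin> X" for q
  proof -
    have "\<Omega> = D - (\<sigma> \<union> \<tau>)" by (auto simp: \<Omega>_def D1_def D2_def)
    then have "q \<in> frontier D \<union> (\<sigma> \<union> \<tau>)"
      using q(1) frontier_slit_domain[of "\<sigma> \<union> \<tau>" D] \<sigma>(1) \<tau>(1) by auto
    then consider "q \<in> frontier D" "q \<notin> \<sigma>" "q \<notin> \<tau>" | "q \<in> \<sigma>" "q \<in> D" | "q \<in> \<tau>" "q \<in> D"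
      using q(2) D(1) by (auto simp: X_def frontier_def interior_open)
    then have "\<exists>l. (u \<longlongrightarrow> l) (at q within \<Omega>) \<and> (W \<longlongrightarrow> l) (at q within \<Omega>)"
    proof cases
      case 1
      have "(f \<longlongrightarrow> f q) (at q within frontier D)" using f_cont 1 q(2) by (simp add: X_def)
      with 1 show ?thesis
        using u_lim[OF u_bdry \<Omega>(5,3)] tendsto_within_subset[OF W_bdry \<Omega>(5)] by blast
    next
      case 2
      then have W: "isCont W q" using disj by (intro W_isCont) (auto simp: D2_def)
      with 2 have "(u \<longlongrightarrow> W q) (at q within \<Omega>)" by (intro u_lim[OF u_slit \<Omega>(3,3)])
      with tendsto_within_subset[OF isContD[OF W] subset_UNIV] show ?thesis by blast
    next
      case 3
      then have u: "isCont u q" using disj by (intro u_isCont) (auto simp: D1_def)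
      with 3 have "(W \<longlongrightarrow> u q) (at q within \<Omega>)"
        by (intro tendsto_within_subset[OF W_slit \<Omega>(4)])
      with tendsto_within_subset[OF isContD[OF u] subset_UNIV] show ?thesis by blast
    qed
    then show ?thesis using tendsto_diff by fastforce
  qed
  have u_eq_W: "u z = W z" if z: "z \<in> \<Omega>" for z
  proof (rule antisym)
    have hu: "harmonic_on u \<Omega>" and hW: "harmonic_on W \<Omega>"
      using harmonic_on_subset[OF harm_u \<Omega>(1,3)] harmonic_on_subset[OF harm_W \<Omega>(1,4)] by auto
    have bd: "u x - W x \<le> Mu + N2" "W x - u x \<le> Mu + N2" if "x \<in> \<Omega>" for x
      using Mu[of x] W_bd[of x] that \<Omega>(3,4) by (auto simp: subset_iff)
    have "u z - W z \<le> 0"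
      by (rule harmonic_maximum_principle_except_finite[OF harmonic_on_diff[OF hu hW] \<Omega>(2) X
            bd(1) diff_lim z])
    then show "u z \<le> W z" by simp
    have lim': "((\<lambda>z. W z - u z) \<longlongrightarrow> 0) (at q within \<Omega>)" if "q \<in> frontier \<Omega>" "q \<notin> X" for q
      using tendsto_minus[OF diff_lim[OF that]] by simp
    have "W z - u z \<le> 0"
      by (rule harmonic_maximum_principle_except_finite[OF harmonic_on_diff[OF hW hu] \<Omega>(2) X
            bd(2) lim' z])
    then show "W z \<le> u z" by simp
  qed
  define U where "U z = (if z \<in> D1 then u z else W z)" for z
  have U_W: "U z = W z" if "z \<in> D2" for z using that u_eq_W by (auto simp: U_def \<Omega>_def)
  have U_u: "U z = u z" if "z \<in> D1" for z using that by (simp add: U_def)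
  have "D1 \<union> D2 = D" using disj by (auto simp: D1_def D2_def)
  moreover have "harmonic_on U (D1 \<union> D2)"
    using harmonic_on_cong[OF harm_u U_u] harmonic_on_cong[OF harm_W U_W] by (intro harmonic_on_Un)
  ultimately have "harmonic_on U D" by simp
  moreover have "(U \<longlongrightarrow> f \<zeta>) (at \<zeta> within D)"
    if \<zeta>: "\<zeta> \<in> frontier D" "(f \<longlongrightarrow> f \<zeta>) (at \<zeta> within frontier D)" for \<zeta>
  proof (cases "\<zeta> \<in> \<sigma>")
    case False
    have "(u \<longlongrightarrow> f \<zeta>) (at \<zeta> within D1)"
      by (rule u_lim[OF u_bdry]) (use \<zeta> False in \<open>auto simp: D1_def\<close>)
    then have "(U \<longlongrightarrow> f \<zeta>) (at \<zeta> within D1)"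
      by (rule Lim_transform_eventually) (auto simp: eventually_at_filter U_u)
    moreover have "at \<zeta> within D \<le> at \<zeta> within D1"
      by (rule at_within_le_nhd[of "- \<sigma>"]) (use \<sigma>(1) False in \<open>auto simp: D1_def\<close>)
    ultimately show ?thesis by (rule tendsto_mono[rotated])
  next
    case True
    then have "\<zeta> \<notin> \<tau>" using disj by blast
    then have "(W \<longlongrightarrow> f \<zeta>) (at \<zeta> within D2)"
      by (intro tendsto_within_subset[OF W_bdry]) (use \<zeta> in \<open>auto simp: D2_def\<close>)
    then have "(U \<longlongrightarrow> f \<zeta>) (at \<zeta> within D2)"
      by (rule Lim_transform_eventually) (auto simp: eventually_at_filter U_W)
    moreover have "at \<zeta> within D \<le> at \<zeta> within D2"
      by (rule at_within_le_nhd[of "- \<tau>"]) (use \<tau>(1) \<open>\<zeta> \<notin> \<tau>\<close> in \<open>auto simp: D2_def\<close>)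
    ultimately show ?thesis by (rule tendsto_mono[rotated])
  qed
  ultimately show ?thesis using U_u unfolding D1_def by blast
qed

end

theorem lemma3p2:
  fixes n :: nat and D D1 D2 \<sigma> \<tau> :: "complex set"
    and s t :: "nat \<Rightarrow> real \<Rightarrow> complex"
    and \<phi>1 \<phi>2 :: "complex \<Rightarrow> complex"
    and f u :: "complex \<Rightarrow> real"
  assumes "n \<ge> 2"
    and "bounded_jordan_domain n D"
    and "piecewise_continuous_on_boundary D f"
    and "\<And>j. j \<in> {1..<n} \<Longrightarrow> crosscut D (s j)"
    and "\<And>j. j \<in> {1..<n} \<Longrightarrow> crosscut D (t j)"
    and "disjoint_family_on (\<lambda>j. path_image (s j)) {1..<n}"
    and "disjoint_family_on (\<lambda>j. path_image (t j)) {1..<n}"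
    and "\<sigma> = (\<Union>j\<in>{1..<n}. path_image (s j))"
    and "\<tau> = (\<Union>j\<in>{1..<n}. path_image (t j))"
    and "\<sigma> \<inter> \<tau> = {}"
    and "D1 = D - \<sigma>"
    and "D2 = D - \<tau>"
    and "simply_connected D1"
    and "simply_connected D2"
    and "extended_riemann_map \<phi>1 D1"
    and "extended_riemann_map \<phi>2 D2"
    and "u \<in> BHarm D1"
    and "\<And>z. z \<in> D1 \<Longrightarrow> F_op D f \<sigma> \<tau> \<phi>1 \<phi>2 u z = u z"
  shows "\<exists>U. harmonic_on U D \<and> (\<forall>z\<in>D1. U z = u z) \<and>
           (\<forall>\<zeta>\<in>frontier D. continuous (at \<zeta> within frontier D) f \<longrightarrow>
              (U \<longlongrightarrow> f \<zeta>) (at \<zeta> within D))"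
proof -
  note D1 = assms(11) and D2 = assms(12)
  obtain E Mf where f: "finite E"
    "\<And>\<zeta>. \<zeta> \<in> frontier D - E \<Longrightarrow> (f \<longlongrightarrow> f \<zeta>) (at \<zeta> within frontier D)"
    "\<And>\<zeta>. \<zeta> \<in> frontier D \<Longrightarrow> \<bar>f \<zeta>\<bar> \<le> Mf"
    using piecewise_continuous_on_boundaryD[OF assms(2,3)] by metis
  have \<sigma>: "closed \<sigma>" "finite (\<sigma> - D)" "\<sigma> \<subseteq> closure D"
    using slits_topology[of "{1..<n}" D s \<sigma>] assms(4,8) by auto
  have \<tau>: "closed \<tau>" "finite (\<tau> - D)"
    using slits_topology[of "{1..<n}" D t \<tau>] assms(5,9) by auto
  interpret slit_pair D \<sigma> \<tau> E \<phi>1 \<phi>2 f Mf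
  proof
    show "open D" "bounded D" using assms(2) by (auto simp: bounded_jordan_domain_def)
  qed (use f \<sigma> \<tau> assms(10,15,16) D1 D2 in auto)
  have u: "harmonic_on u (D - \<sigma>)" using assms(17) by (simp add: BHarm_def D1)
  obtain Mu where Mu: "\<And>z. z \<in> D - \<sigma> \<Longrightarrow> \<bar>u z\<bar> \<le> Mu"
    using assms(17) unfolding BHarm_def bounded_iff D1 by auto
  have "u z = poisson_integral \<phi>1 UNIV (\<lambda>x. outer_data x + data_on \<sigma>
      (poisson_integral \<phi>2 UNIV (\<lambda>x. outer_data x + data_on \<tau> u x)) x) z" if "z \<in> D - \<sigma>" for z
    by (rule fixed_point_representation[OF u Mu _ that]) (use assms(18) D1 in auto)
  from coupled_solutions_glue[OF u Mu this] show ?thesis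
    by (simp add: continuous_within D1)
qed

end
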